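(* Let $F: X_h \to \mathbb{R}$ be $\alpha$-strongly convex for some $\alpha>0$ and Fréchet differentiable with $\beta$-Lipschitz continuous derivative for some $\beta>0$, and put $\kappa = \beta/\alpha$. Let $\{W_k\}_{k=1}^N$ be a space decomposition of $Y_h$ which satisfies the stable decomposition assumption with constants $c_1>0$, $c_2\ge 0$. Let $\tau\in(0,1/N]$, let $\mathbf{p}^{(0)}\in C$, and let $\{\mathbf{p}^{(n)}\}_{n\ge 0}$ be generated by the additive Schwarz method. Let $\mathbf{p}^*$ be a solution of $\min_{\mathbf{p}\in C}\mathcal{F}(\mathbf{p})$, and let $\zeta_n = \alpha\left(\mathcal{F}(\mathbf{p}^{(n)})-\mathcal{F}(\mathbf{p}^* )\right)$ for $n\ge 0$. Then there exists a constant $\tilde c>0$ depending only on $|\Omega|$, $\kappa$, $\tau$, $\zeta_0$, $c_1$, and $c_2$ such that $$\zeta_n \le \frac{1}{\tilde c\, n + 1/\zeta_0}\quad \text{for all } n\ge 0,$$ where the right-hand side is read as $0$ if $\zeta_0=0$.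
   Context: Discretization. Let $\Omega=(0,m_1h)\times(0,m_2h)\subset\mathbb{R}^2$ be partitioned into $m_1\times m_2$ square elements of side length $h$; $\mathcal{T}_h$ is the collection of elements and $\mathcal{E}_h$ the collection of interior element edges. $X_h$ is the space of functions in $L^2(\Omega)$ that are constant on each $T\in\mathcal{T}_h$; $(u)_T$ denotes the value of $u \in X_h$ on $T$. $Y_h=\{\mathbf{p}\in H_0(\mathrm{div};\Omega): \mathbf{p}|_T\in\mathcal{RT}_0(T)\ \forall T\in\mathcal{T}_h\}$, where $H_0(\mathrm{div};\Omega)$ is the space of $\mathbf{p}\in (L^2(\Omega))^2$ with $\mathrm{div}\,\mathbf{p}\in L^2(\Omega)$ and zero normal component on $\partial\Omega$, and $\mathcal{RT}_0(T)$ is the set of vector fields on $T$ of the form $(x_1,x_2)\mapsto(a_1+b_1x_1,\ a_2+b_2x_2)$. For $\mathbf{p}\in Y_h$ and $e\in\mathcal{E}_h$, $(\mathbf{p})_e=\frac{1}{|e|}\int_e\mathbf{p}\cdot\mathbf{n}_e\,ds$ with $\mathbf{n}_e$ a fixed unit normal to $e$. The inner products are $\langle u,v\rangle_{X_h}=h^2\sum_{T\in\mathcal{T}_h}(u)_T(v)_T$ and $\langle\mathbf{p},\mathbf{q}\rangle_{Y_h}=h^2\sum_{e\in\mathcal{E}_h}(\mathbf{p})_e(\mathbf{q})_e$, with induced norms both written $\|\cdot\|$. The operator $\mathrm{div}$ maps $Y_h$ into $X_h$. Let $C=\{\mathbf{p}\in Y_h: |(\mathbf{p})_e|\le 1\ \forall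 e\in\mathcal{E}_h\}$. Functional. $F$ is $\alpha$-strongly convex if $u\mapsto F(u)-\frac{\alpha}{2}\|u\|^2$ is convex; $F'$ is $\beta$-Lipschitz if $\|F'(u)-F'(v)\|\le\beta\|u-v\|$ for all $u,v\in X_h$. $F^*$ is the Legendre–Fenchel conjugate of $F$ on $X_h$ (with respect to $\langle\cdot,\cdot\rangle_{X_h}$), and $\mathcal{F}(\mathbf{p})=F^*(\mathrm{div}\,\mathbf{p})$ for $\mathbf{p}\in Y_h$. Space decomposition. $W_1,\dots,W_N$ are subspaces of $W=Y_h$ with $W=\sum_{k=1}^N R_k^*W_k$, where $R_k^*:W_k\to W$ is the natural extension operator, adjoint to the restriction operator $R_k:W\to W_k$. Stable decomposition assumption with constants $c_1>0$, $c_2\ge0$: for any $\mathbf{p},\mathbf{q}\in C$ there exist $\mathbf{r}_k\in W_k$ ($k=1,\dots,N$) such that $\mathbf{p}-\mathbf{q}=\sum_{k=1}^N R_k^*\mathbf{r}_k$; $\mathbf{q}+R_k^*\mathbf{r}_k\in C$ for each $k$; and $\sum_{k=1}^N\|\mathrm{div}\,R_k^*\mathbf{r}_k\|^2\le c_1\|\mathrm{div}(\mathbf{p}-\mathbf{q})\|^2+c_2\|\mathbf{p}-\mathbf{q}\|^2$. Additive Schwarz method. Given $\mathbf{p}^{(0)}\in C$ and $\tau\in(0,1/N]$, for $n=0,1,2,\dots$: choose, for each $k=1,\dots,N$, $\mathbf{r}_k^{(n+1)}$ to be a minimizer of $\mathcal{F}(\mathbf{p}^{(n)}+R_k^*\mathbf{r}_k)$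 over all $\mathbf{r}_k\in W_k$ with $\mathbf{p}^{(n)}+R_k^*\mathbf{r}_k\in C$, and set $\mathbf{p}^{(n+1)}=\mathbf{p}^{(n)}+\tau\sum_{k=1}^N R_k^*\mathbf{r}_k^{(n+1)}$. *)

theory Defs
  imports "HOL-Analysis.Analysis" "HOL-Library.Function_Algebras"
begin

(* Function_Algebras provides the pointwise additive structure on functions; with the pointwise
   scalar multiplication, spaces of functions and vector fields can be treated by the library
   notions subspace and convex_on. *)

instantiation "fun" :: (type, real_vector) real_vector
begin

definition scaleR_fun :: "real \<Rightarrow> ('a \<Rightarrow> 'b) \<Rightarrow> 'a \<Rightarrow> 'b"
  where "scaleR_fun c f = (\<lambda>x. c *\<^sub>R f x)"

instance
  by standard (auto simp: scaleR_fun_def fun_eq_iff algebra_simps)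

end

type_synonym point = "real \<times> real"
type_synonym scalar_field = "point \<Rightarrow> real"
type_synonym vector_field = "point \<Rightarrow> point"


section \<open>The Sobolev space of fields with square integrable divergence\<close>

definition square_integrable :: "point set \<Rightarrow> (point \<Rightarrow> 'b::euclidean_space) \<Rightarrow> bool"
  where "square_integrable \<Omega> f \<longleftrightarrow>
    set_borel_measurable lborel \<Omega> f \<and> set_integrable lborel \<Omega> (\<lambda>x. (norm (f x))\<^sup>2)"

definition C1_with_gradient :: "scalar_field \<Rightarrow> vector_field \<Rightarrow> bool"
  where "C1_with_gradient \<phi> G \<longleftrightarrow>
    (\<forall>x. (\<phi> has_derivative (\<lambda>v. G x \<bullet> v)) (at x)) \<and> continuous_on UNIV G"

definition compactly_supported_in :: "point set \<Rightarrow> scalar_field \<Rightarrow> bool"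
  where "compactly_supported_in \<Omega> \<phi> \<longleftrightarrow>
    (\<exists>K. compact K \<and> K \<subseteq> \<Omega> \<and> (\<forall>x. x \<notin> K \<longrightarrow> \<phi> x = 0))"

definition weak_divergence :: "point set \<Rightarrow> vector_field \<Rightarrow> scalar_field \<Rightarrow> bool"
  where "weak_divergence \<Omega> p d \<longleftrightarrow>
    square_integrable \<Omega> d \<and>
    (\<forall>\<phi> G. C1_with_gradient \<phi> G \<longrightarrow> compactly_supported_in \<Omega> \<phi> \<longrightarrow>
       (LINT x:\<Omega>|lborel. p x \<bullet> G x) = - (LINT x:\<Omega>|lborel. d x * \<phi> x))"

(* The normal trace of p on the boundary is the functional that sends (the trace of) a function phi
   to the integral of p . grad phi + (div p) phi. It vanishes iff it does so on all phi that are
   continuously differentiable up to the boundary, these being dense in H^1. *)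

definition zero_normal_trace :: "point set \<Rightarrow> vector_field \<Rightarrow> scalar_field \<Rightarrow> bool"
  where "zero_normal_trace \<Omega> p d \<longleftrightarrow>
    (\<forall>\<phi> G. C1_with_gradient \<phi> G \<longrightarrow>
       (LINT x:\<Omega>|lborel. p x \<bullet> G x + d x * \<phi> x) = 0)"

definition H0_div :: "point set \<Rightarrow> vector_field set"
  where "H0_div \<Omega> = {p. square_integrable \<Omega> p \<and>
    (\<exists>d. weak_divergence \<Omega> p d \<and> zero_normal_trace \<Omega> p d)}"


section \<open>The grid\<close>

definition domain :: "nat \<Rightarrow> nat \<Rightarrow> real \<Rightarrow> point set"
  where "domain m1 m2 h = {0<..<real m1 * h} \<times> {0<..<real m2 * h}"

definition cell :: "real \<Rightarrow> nat \<Rightarrow> nat \<Rightarrow> point set"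
  where "cell h i j =
    {real i * h<..<real (Suc i) * h} \<times> {real j * h<..<real (Suc j) * h}"

definition elements :: "nat \<Rightarrow> nat \<Rightarrow> real \<Rightarrow> point set set"
  where "elements m1 m2 h = {cell h i j | i j. i < m1 \<and> j < m2}"

(* VEdge i j is the edge shared by cells (i, j) and (i + 1, j),
   HEdge i j the one shared by cells (i, j) and (i, j + 1). *)

datatype edge = VEdge nat nat | HEdge nat nat

definition interior_edges :: "nat \<Rightarrow> nat \<Rightarrow> edge set"
  where "interior_edges m1 m2 =
    {VEdge i j | i j. Suc i < m1 \<and> j < m2} \<union> {HEdge i j | i j. i < m1 \<and> Suc j < m2}"

fun edge_start :: "real \<Rightarrow> edge \<Rightarrow> point"
  where "edge_start h (VEdge i j) = (real (Suc i) * h, real j * h)"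
  | "edge_start h (HEdge i j) = (real i * h, real (Suc j) * h)"

fun edge_tangent :: "edge \<Rightarrow> point"
  where "edge_tangent (VEdge i j) = (0, 1)"
  | "edge_tangent (HEdge i j) = (1, 0)"

fun edge_normal :: "edge \<Rightarrow> point"
  where "edge_normal (VEdge i j) = (1, 0)"
  | "edge_normal (HEdge i j) = (0, 1)"

fun edge_cell :: "real \<Rightarrow> edge \<Rightarrow> point set"
  where "edge_cell h (VEdge i j) = cell h i j"
  | "edge_cell h (HEdge i j) = cell h i j"


section \<open>The finite element spaces\<close>

(* Elements of L^2 are classes of functions modulo null sets. A class in X_h or Y_h is represented
   by its unique member that has the prescribed form on every open element and vanishes off the
   union of the open elements. Thus equality of functions is equality in X_h and Y_h. *)

definition normalized :: "nat \<Rightarrow> nat \<Rightarrow> real \<Rightarrow> (point \<Rightarrow> 'b::zero) \<Rightarrow> bool"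
  where "normalized m1 m2 h f \<longleftrightarrow> (\<forall>x. x \<notin> \<Union>(elements m1 m2 h) \<longrightarrow> f x = 0)"

definition X_h :: "nat \<Rightarrow> nat \<Rightarrow> real \<Rightarrow> scalar_field set"
  where "X_h m1 m2 h = {u. square_integrable (domain m1 m2 h) u \<and> normalized m1 m2 h u \<and>
    (\<forall>T\<in>elements m1 m2 h. \<exists>c. \<forall>x\<in>T. u x = c)}"

definition RT0 :: "point set \<Rightarrow> vector_field \<Rightarrow> bool"
  where "RT0 T p \<longleftrightarrow>
    (\<exists>a1 b1 a2 b2. \<forall>x\<in>T. p x = (a1 + b1 * fst x, a2 + b2 * snd x))"

definition Y_h :: "nat \<Rightarrow> nat \<Rightarrow> real \<Rightarrow> vector_field set"
  where "Y_h m1 m2 h = {p \<in> H0_div (domain m1 m2 h). normalized m1 m2 h p \<and>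
    (\<forall>T\<in>elements m1 m2 h. RT0 T p)}"

definition div_h :: "nat \<Rightarrow> nat \<Rightarrow> real \<Rightarrow> vector_field \<Rightarrow> scalar_field"
  where "div_h m1 m2 h p = (THE u. u \<in> X_h m1 m2 h \<and> weak_divergence (domain m1 m2 h) p u)"

definition value_on :: "scalar_field \<Rightarrow> point set \<Rightarrow> real"
  where "value_on u T = (THE c. \<forall>x\<in>T. u x = c)"

(* The trace of p . n_e on e is taken from the element on the lower left of e; for p in Y_h the
   trace from the other side is the same, since p has a square integrable divergence. *)

definition normal_trace :: "real \<Rightarrow> vector_field \<Rightarrow> edge \<Rightarrow> point \<Rightarrow> real"
  where "normal_trace h p e x = Lim (at x within edge_cell h e) (\<lambda>y. p y \<bullet> edge_normal e)"

definition edge_mean :: "real \<Rightarrow> vector_field \<Rightarrow> edge \<Rightarrow> real"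
  where "edge_mean h p e =
    1 / h * integral {0..h} (\<lambda>s. normal_trace h p e (edge_start h e + s *\<^sub>R edge_tangent e))"

definition inner_X :: "nat \<Rightarrow> nat \<Rightarrow> real \<Rightarrow> scalar_field \<Rightarrow> scalar_field \<Rightarrow> real"
  where "inner_X m1 m2 h u v = h\<^sup>2 * (\<Sum>T\<in>elements m1 m2 h. value_on u T * value_on v T)"

definition norm_X :: "nat \<Rightarrow> nat \<Rightarrow> real \<Rightarrow> scalar_field \<Rightarrow> real"
  where "norm_X m1 m2 h u = sqrt (inner_X m1 m2 h u u)"

definition inner_Y :: "nat \<Rightarrow> nat \<Rightarrow> real \<Rightarrow> vector_field \<Rightarrow> vector_field \<Rightarrow> real"
  where "inner_Y m1 m2 h p q = h\<^sup>2 * (\<Sum>e\<in>interior_edges m1 m2. edge_mean h p e * edge_mean h q e)"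

definition norm_Y :: "nat \<Rightarrow> nat \<Rightarrow> real \<Rightarrow> vector_field \<Rightarrow> real"
  where "norm_Y m1 m2 h p = sqrt (inner_Y m1 m2 h p p)"

definition C_h :: "nat \<Rightarrow> nat \<Rightarrow> real \<Rightarrow> vector_field set"
  where "C_h m1 m2 h = {p \<in> Y_h m1 m2 h. \<forall>e\<in>interior_edges m1 m2. \<bar>edge_mean h p e\<bar> \<le> 1}"


section \<open>The functionals\<close>

(* A functional on X_h is given by a total function of which only the values on X_h matter. *)

definition strongly_convex_X ::
    "nat \<Rightarrow> nat \<Rightarrow> real \<Rightarrow> real \<Rightarrow> (scalar_field \<Rightarrow> real) \<Rightarrow> bool"
  where "strongly_convex_X m1 m2 h \<alpha> F \<longleftrightarrow>
    convex_on (X_h m1 m2 h) (\<lambda>u. F u - \<alpha> / 2 * (norm_X m1 m2 h u)\<^sup>2)"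

(* The Frechet derivative of F at u, identified with an element g of X_h by means of the inner
   product of X_h. *)

definition has_frechet_derivative_X ::
    "nat \<Rightarrow> nat \<Rightarrow> real \<Rightarrow> (scalar_field \<Rightarrow> real) \<Rightarrow> scalar_field \<Rightarrow> scalar_field \<Rightarrow> bool"
  where "has_frechet_derivative_X m1 m2 h F g u \<longleftrightarrow> g \<in> X_h m1 m2 h \<and>
    (\<forall>\<epsilon>>0. \<exists>\<delta>>0. \<forall>v\<in>X_h m1 m2 h. norm_X m1 m2 h v < \<delta> \<longrightarrow>
       \<bar>F (u + v) - F u - inner_X m1 m2 h g v\<bar> \<le> \<epsilon> * norm_X m1 m2 h v)"

definition has_lipschitz_derivative_X ::
    "nat \<Rightarrow> nat \<Rightarrow> real \<Rightarrow> real \<Rightarrow> (scalar_field \<Rightarrow> real) \<Rightarrow> bool"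
  where "has_lipschitz_derivative_X m1 m2 h \<beta> F \<longleftrightarrow>
    (\<exists>F'. (\<forall>u\<in>X_h m1 m2 h. has_frechet_derivative_X m1 m2 h F (F' u) u) \<and>
      (\<forall>u\<in>X_h m1 m2 h. \<forall>v\<in>X_h m1 m2 h.
         norm_X m1 m2 h (F' u - F' v) \<le> \<beta> * norm_X m1 m2 h (u - v)))"

(* The supremum is taken in the reals; it is finite for the strongly convex functionals with
   Frechet derivative to which the conjugate is applied. *)

definition conjugate_X ::
    "nat \<Rightarrow> nat \<Rightarrow> real \<Rightarrow> (scalar_field \<Rightarrow> real) \<Rightarrow> scalar_field \<Rightarrow> real"
  where "conjugate_X m1 m2 h F v = (SUP u\<in>X_h m1 m2 h. inner_X m1 m2 h u v - F u)"

definition dual_energy ::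
    "nat \<Rightarrow> nat \<Rightarrow> real \<Rightarrow> (scalar_field \<Rightarrow> real) \<Rightarrow> vector_field \<Rightarrow> real"
  where "dual_energy m1 m2 h F p = conjugate_X m1 m2 h F (div_h m1 m2 h p)"

definition minimizes :: "('a \<Rightarrow> real) \<Rightarrow> 'a set \<Rightarrow> 'a \<Rightarrow> bool"
  where "minimizes f S x \<longleftrightarrow> x \<in> S \<and> (\<forall>y\<in>S. f x \<le> f y)"


section \<open>Space decompositions and the additive Schwarz method\<close>

(* The local spaces W 1, ..., W N are subspaces of Y_h, so the extension operators R_k^* are
   inclusions and do not show up in the formulas. *)

definition space_decomposition ::
    "nat \<Rightarrow> nat \<Rightarrow> real \<Rightarrow> nat \<Rightarrow> (nat \<Rightarrow> vector_field set) \<Rightarrow> bool"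
  where "space_decomposition m1 m2 h N W \<longleftrightarrow> 1 \<le> N \<and>
    (\<forall>k\<in>{1..N}. subspace (W k) \<and> W k \<subseteq> Y_h m1 m2 h) \<and>
    Y_h m1 m2 h = {\<Sum>k=1..N. r k | r. \<forall>k\<in>{1..N}. r k \<in> W k}"

definition stable_decomposition ::
    "nat \<Rightarrow> nat \<Rightarrow> real \<Rightarrow> nat \<Rightarrow> (nat \<Rightarrow> vector_field set) \<Rightarrow> real \<Rightarrow> real \<Rightarrow> bool"
  where "stable_decomposition m1 m2 h N W c1 c2 \<longleftrightarrow>
    (\<forall>p\<in>C_h m1 m2 h. \<forall>q\<in>C_h m1 m2 h. \<exists>r.
       (\<forall>k\<in>{1..N}. r k \<in> W k) \<and>
       p - q = (\<Sum>k=1..N. r k) \<and>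
       (\<forall>k\<in>{1..N}. q + r k \<in> C_h m1 m2 h) \<and>
       (\<Sum>k=1..N. (norm_X m1 m2 h (div_h m1 m2 h (r k)))\<^sup>2)
         \<le> c1 * (norm_X m1 m2 h (div_h m1 m2 h (p - q)))\<^sup>2 + c2 * (norm_Y m1 m2 h (p - q))\<^sup>2)"

definition additive_schwarz ::
    "nat \<Rightarrow> nat \<Rightarrow> real \<Rightarrow> (scalar_field \<Rightarrow> real) \<Rightarrow> nat \<Rightarrow> (nat \<Rightarrow> vector_field set) \<Rightarrow> real
      \<Rightarrow> (nat \<Rightarrow> vector_field) \<Rightarrow> bool"
  where "additive_schwarz m1 m2 h F N W \<tau> p \<longleftrightarrow>
    p 0 \<in> C_h m1 m2 h \<and>
    (\<forall>n. \<exists>r.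
       (\<forall>k\<in>{1..N}. minimizes (\<lambda>s. dual_energy m1 m2 h F (p n + s))
          {s \<in> W k. p n + s \<in> C_h m1 m2 h} (r k)) \<and>
       p (Suc n) = p n + \<tau> *\<^sub>R (\<Sum>k=1..N. r k))"

end

theory Submission
  imports Defs "HOL-Real_Asymp.Real_Asymp"
begin

text \<open>
  Write \<open>\<F> = F\<^sup>* \<circ> div\<close>. The conjugate \<open>F\<^sup>*\<close> is \<open>1/\<beta>\<close>-strongly convex and has a \<open>1/\<alpha>\<close>-Lipschitz gradient.
  Since \<open>\<tau> N \<le> 1\<close>, the new iterate is a convex combination of \<open>p\<^sub>n\<close> and the locally corrected fields
  \<open>p\<^sub>n + r\<^sub>k\<close>. Comparing each \<open>r\<^sub>k\<close> with the candidate \<open>t s\<^sub>k\<close>, where \<open>p\<^sup>* - p\<^sub>n = \<Sum> s\<^sub>k\<close> is a stable decomposition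
  and \<open>0 \<le> t \<le> 1\<close>, and using smoothness of \<open>F\<^sup>*\<close>,
  \<open>\<zeta>\<^sub>n\<^sub>+\<^sub>1 \<le> \<zeta>\<^sub>n - \<tau> (t \<zeta>\<^sub>n - t\<^sup>2/2 (c1 \<parallel>div (p\<^sup>* - p\<^sub>n)\<parallel>\<^sup>2 + c2 \<parallel>p\<^sup>* - p\<^sub>n\<parallel>\<^sup>2))\<close>.
  Strong convexity of \<open>F\<^sup>*\<close> at the minimizer gives \<open>\<parallel>div (p\<^sup>* - p\<^sub>n)\<parallel>\<^sup>2 \<le> 2 \<kappa> \<zeta>\<^sub>n \<le> 2 \<kappa> \<zeta>\<^sub>0\<close>, and the pointwise
  constraint gives \<open>\<parallel>p\<^sup>* - p\<^sub>n\<parallel>\<^sup>2 \<le> 8 |\<Omega>|\<close>. With \<open>K = \<kappa> c1 \<zeta>\<^sub>0 + 4 c2 |\<Omega>| + \<zeta>\<^sub>0\<close> and \<open>t = \<zeta>\<^sub>n / (2 K)\<close> this becomes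
  \<open>\<zeta>\<^sub>n\<^sub>+\<^sub>1 \<le> \<zeta>\<^sub>n - \<tau>/(4 K) \<zeta>\<^sub>n\<^sup>2\<close>; the summand \<open>\<zeta>\<^sub>0\<close> of \<open>K\<close> only ensures \<open>t \<le> 1\<close>.

  The linearity of \<open>div\<close> on \<open>Y_h\<close> rests on the fact that the weak divergence of an \<open>RT\<^sub>0\<close> field is, almost
  everywhere on each element, the sum of its two slopes.
\<close>

section \<open>Conjugates of strongly convex functionals on an inner product space\<close>

text \<open>The linearity laws are confined to \<open>X\<close> because \<open>inner_X\<close> reads
  a function through its element values, which are meaningful on \<open>X\<close> only. The form is
  merely positive semidefinite, so equal pairings do not yield equal vectors. Completeness is what
  makes the supremum in the conjugate attained.\<close>

locale complete_inner_subspace =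
  fixes X :: "'a::real_vector set"
    and ip :: "'a \<Rightarrow> 'a \<Rightarrow> real"
    and nrm :: "'a \<Rightarrow> real"
  assumes subspace: "subspace X"
    and ip_commute: "ip u v = ip v u"
    and ip_add_left: "\<lbrakk>u \<in> X; v \<in> X; w \<in> X\<rbrakk> \<Longrightarrow> ip (u + v) w = ip u w + ip v w"
    and ip_scaleR_left: "\<lbrakk>u \<in> X; w \<in> X\<rbrakk> \<Longrightarrow> ip (c *\<^sub>R u) w = c * ip u w"
    and ip_nonneg: "0 \<le> ip u u"
    and nrm_def: "nrm u = sqrt (ip u u)"
    and complete: "\<lbrakk>\<And>n. s n \<in> X; \<forall>\<epsilon>>0. \<exists>M. \<forall>m\<ge>M. \<forall>n\<ge>M. nrm (s m - s n) < \<epsilon>\<rbrakk>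
      \<Longrightarrow> \<exists>l\<in>X. (\<lambda>n. nrm (s n - l)) \<longlonglongrightarrow> 0"
begin

lemma mem_add: "\<lbrakk>u \<in> X; v \<in> X\<rbrakk> \<Longrightarrow> u + v \<in> X"
  and mem_diff: "\<lbrakk>u \<in> X; v \<in> X\<rbrakk> \<Longrightarrow> u - v \<in> X"
  and mem_scaleR: "u \<in> X \<Longrightarrow> c *\<^sub>R u \<in> X"
  and mem_zero: "0 \<in> X"
  using subspace by (auto simp: subspace_add subspace_diff subspace_scale subspace_0)

lemmas mem = mem_add mem_diff mem_scaleR mem_zero

lemma ip_add_right: "\<lbrakk>u \<in> X; v \<in> X; w \<in> X\<rbrakk> \<Longrightarrow> ip w (u + v) = ip w u + ip w v"
  using ip_add_left ip_commute by metis

lemma ip_scaleR_right: "\<lbrakk>u \<in> X; w \<in> X\<rbrakk> \<Longrightarrow> ip w (c *\<^sub>R u) = c * ip w u"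
  using ip_scaleR_left ip_commute by metis

lemma ip_diff_left: "\<lbrakk>u \<in> X; v \<in> X; w \<in> X\<rbrakk> \<Longrightarrow> ip (u - v) w = ip u w - ip v w"
  using ip_add_left[of u "(-1) *\<^sub>R v" w] ip_scaleR_left[of v w "-1"] mem_scaleR[of v "-1"] by simp

lemma ip_diff_right: "\<lbrakk>u \<in> X; v \<in> X; w \<in> X\<rbrakk> \<Longrightarrow> ip w (u - v) = ip w u - ip w v"
  using ip_diff_left ip_commute by metis

lemma ip_zero: "u \<in> X \<Longrightarrow> ip u 0 = 0" "u \<in> X \<Longrightarrow> ip 0 u = 0"
  using ip_scaleR_right[of u u 0] ip_scaleR_left[of u u 0] by auto

lemma ip_sum_right:
  assumes "finite K" "\<And>k. k \<in> K \<Longrightarrow> d k \<in> X" "g \<in> X"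
  shows "ip g (\<Sum>k\<in>K. d k) = (\<Sum>k\<in>K. ip g (d k))"
  using assms
  by (induction K rule: finite_induct) (auto simp: ip_zero ip_add_right subspace_sum[OF subspace])

lemmas ip_lin = ip_add_left ip_add_right ip_scaleR_left ip_scaleR_right ip_diff_left ip_diff_right
  ip_zero

lemma nrm_nonneg: "0 \<le> nrm u"
  by (simp add: nrm_def ip_nonneg)

lemma nrm_sq: "(nrm u)\<^sup>2 = ip u u"
  by (simp add: nrm_def ip_nonneg)

lemma nrm_scaleR: "u \<in> X \<Longrightarrow> nrm (c *\<^sub>R u) = \<bar>c\<bar> * nrm u"
  by (simp add: nrm_def ip_lin mem real_sqrt_mult flip: mult.assoc)

lemma nrm_minus_commute:
  assumes "u \<in> X" "v \<in> X"
  shows "nrm (u - v) = nrm (v - u)"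
  using nrm_scaleR[of "u - v" "-1"] assms by (simp add: mem)

lemma young:
  assumes "u \<in> X" "v \<in> X" "0 < a"
  shows "ip u v \<le> a / 2 * (nrm u)\<^sup>2 + 1 / (2 * a) * (nrm v)\<^sup>2"
proof -
  have "0 \<le> ip (a *\<^sub>R u - v) (a *\<^sub>R u - v)"
    by (rule ip_nonneg)
  also have "\<dots> = a\<^sup>2 * ip u u - 2 * a * ip u v + ip v v"
    using assms by (simp add: ip_lin mem ip_commute[of v u] algebra_simps power2_eq_square)
  finally have "2 * a * ip u v \<le> a\<^sup>2 * ip u u + ip v v"
    by simp
  then show ?thesis
    unfolding nrm_sq using assms by (simp add: field_simps power2_eq_square)
qed

text \<open>Young's inequality is sharp when the weight is the ratio of the two norms. Both norms
  are raised by \<open>d > 0\<close> so that the ratio exists even if one of them vanishes, at a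
  cost of at most \<open>e\<close>.\<close>

lemma Cauchy_Schwarz:
  assumes "u \<in> X" "v \<in> X"
  shows "ip u v \<le> nrm u * nrm v"
proof (rule field_le_epsilon)
  fix e :: real
  assume "0 < e"
  define d where "d = e / (nrm u + nrm v + 1)"
  have d: "0 < d"
    using \<open>0 < e\<close> nrm_nonneg[of u] nrm_nonneg[of v] by (simp add: d_def)
  define x y where "x = nrm u + d" and "y = nrm v + d"
  have xy: "0 < x" "0 < y"
    using d nrm_nonneg[of u] nrm_nonneg[of v] by (auto simp: x_def y_def)
  have "ip u v \<le> y / x / 2 * (nrm u)\<^sup>2 + 1 / (2 * (y / x)) * (nrm v)\<^sup>2"
    using young[OF assms, of "y / x"] xy by simp
  also have "\<dots> \<le> y / x / 2 * (x * nrm u) + x / (2 * y) * (y * nrm v)"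
    using xy d nrm_nonneg[of u] nrm_nonneg[of v]
    by (intro add_mono mult_mono) (auto simp: x_def y_def power2_eq_square intro!: mult_right_mono)
  also have "\<dots> = (y * nrm u + x * nrm v) / 2"
    using xy by (simp add: field_simps)
  also have "\<dots> = nrm u * nrm v + d * (nrm u + nrm v) / 2"
    by (simp add: x_def y_def algebra_simps)
  also have "d * (nrm u + nrm v) / 2 \<le> e"
  proof -
    have "d * (nrm u + nrm v) \<le> d * (nrm u + nrm v + 1)"
      using d by simp
    also have "\<dots> = e"
      using nrm_nonneg[of u] nrm_nonneg[of v] by (simp add: d_def)
    finally show ?thesis
      using \<open>0 < e\<close> by simp
  qed
  finally show "ip u v \<le> nrm u * nrm v + e"
    by simp
qed

section \<open>Gradients, strong convexity and the descent lemma\<close>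

definition gradient_at :: "('a \<Rightarrow> real) \<Rightarrow> 'a \<Rightarrow> 'a \<Rightarrow> bool"
  where "gradient_at F g u \<longleftrightarrow> g \<in> X \<and>
    (\<forall>\<epsilon>>0. \<exists>\<delta>>0. \<forall>v\<in>X. nrm v < \<delta> \<longrightarrow> \<bar>F (u + v) - F u - ip g v\<bar> \<le> \<epsilon> * nrm v)"

lemma gradient_at_line0:
  assumes "gradient_at F g u" "d \<in> X"
  shows "((\<lambda>t. F (u + t *\<^sub>R d)) has_real_derivative ip g d) (at 0)"
  unfolding DERIV_def
proof (rule LIM_I)
  fix e :: real
  assume "0 < e"
  have g: "g \<in> X"
    using assms by (simp add: gradient_at_def)
  have n: "0 < nrm d + 1"
    using nrm_nonneg[of d] by simp
  \<comment> \<open>Halving \<open>e\<close> makes the final inequality strict, and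
    \<open>+ 1\<close> keeps the quotient meaningful when \<open>nrm d = 0\<close>.\<close>
  define \<epsilon> where "\<epsilon> = e / 2 / (nrm d + 1)"
  have "0 < \<epsilon>"
    using \<open>0 < e\<close> n by (simp add: \<epsilon>_def)
  then obtain \<delta> where \<delta>: "0 < \<delta>"
    "\<And>v. v \<in> X \<Longrightarrow> nrm v < \<delta> \<Longrightarrow> \<bar>F (u + v) - F u - ip g v\<bar> \<le> \<epsilon> * nrm v"
    using assms(1) unfolding gradient_at_def by blast
  show "\<exists>s>0. \<forall>t. t \<noteq> 0 \<and> norm (t - 0) < s \<longrightarrow>
      norm ((F (u + (0 + t) *\<^sub>R d) - F (u + 0 *\<^sub>R d)) / t - ip g d) < e"
  proof (intro exI[of _ "\<delta> / (nrm d + 1)"] conjI allI impI)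
    show "0 < \<delta> / (nrm d + 1)"
      using \<delta> n by simp
    fix t :: real
    assume t: "t \<noteq> 0 \<and> norm (t - 0) < \<delta> / (nrm d + 1)"
    have "\<bar>t\<bar> * nrm d \<le> \<bar>t\<bar> * (nrm d + 1)"
      by (simp add: mult_left_mono)
    also have "\<dots> < \<delta>"
      using t n by (simp add: field_simps)
    finally have "\<bar>F (u + t *\<^sub>R d) - F u - ip g (t *\<^sub>R d)\<bar> \<le> \<epsilon> * nrm (t *\<^sub>R d)"
      using \<delta>(2)[of "t *\<^sub>R d"] assms(2) by (simp add: nrm_scaleR mem)
    then have "\<bar>F (u + t *\<^sub>R d) - F u - t * ip g d\<bar> \<le> \<epsilon> * (\<bar>t\<bar> * nrm d)"
      using assms(2) g by (simp add: nrm_scaleR ip_lin)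
    then have "\<bar>(F (u + t *\<^sub>R d) - F u) / t - ip g d\<bar> \<le> \<epsilon> * nrm d"
      using t by (simp add: divide_simps abs_if split: if_splits) (simp_all add: algebra_simps)
    also have "\<dots> \<le> \<epsilon> * (nrm d + 1)"
      using \<open>0 < \<epsilon>\<close> by simp
    also have "\<dots> < e"
    proof -
      have "\<epsilon> * (nrm d + 1) = e / 2"
        using n eq_divide_eq[of \<epsilon> "e / 2" "nrm d + 1"] by (simp add: \<epsilon>_def)
      then show ?thesis
        using \<open>0 < e\<close> by simp
    qed
    finally show "norm ((F (u + (0 + t) *\<^sub>R d) - F (u + 0 *\<^sub>R d)) / t - ip g d) < e"
      by simp
  qed
qed

lemma gradient_at_line:
  assumes "gradient_at F g (u + s *\<^sub>R d)" "d \<in> X"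
  shows "((\<lambda>t. F (u + t *\<^sub>R d)) has_real_derivative ip g d) (at s)"
proof -
  have "((\<lambda>t. F (u + (s + t) *\<^sub>R d)) has_real_derivative ip g d) (at 0)"
    using gradient_at_line0[OF assms] by (simp add: algebra_simps)
  then show ?thesis
    using DERIV_at_within_shift[of "\<lambda>t. F (u + t *\<^sub>R d)" "ip g d" s 0 UNIV] by simp
qed

text \<open>On the segment from \<open>u\<close> to \<open>v\<close> the slack \<open>K\<close> in
  the strong convexity inequality is nonnegative and vanishes at 0, so its derivative at 0 cannot be
  negative. That derivative is the gap between the two sides.\<close>

lemma strongly_convex_gradient_bound:
  assumes "convex_on X (\<lambda>u. F u - \<alpha> / 2 * (nrm u)\<^sup>2)" "gradient_at F g u" "u \<in> X" "v \<in> X"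
  shows "F u + ip g (v - u) + \<alpha> / 2 * (nrm (v - u))\<^sup>2 \<le> F v"
proof -
  define d where "d = v - u"
  have d: "d \<in> X"
    using assms by (simp add: d_def mem)
  define K where "K = (\<lambda>t. t * (F v - F u) - \<alpha> / 2 * (t * (1 - t)) * (nrm d)\<^sup>2 - (F (u + t *\<^sub>R d) - F u))"
  have K_nonneg: "0 \<le> K t" if "0 \<le> t" "t \<le> 1" for t
  proof -
    have *: "(1 - t) *\<^sub>R u + t *\<^sub>R v = u + t *\<^sub>R d"
      by (simp add: d_def algebra_simps)
    have le: "F (u + t *\<^sub>R d) - \<alpha> / 2 * (nrm (u + t *\<^sub>R d))\<^sup>2
        \<le> (1 - t) * (F u - \<alpha> / 2 * (nrm u)\<^sup>2) + t * (F v - \<alpha> / 2 * (nrm v)\<^sup>2)"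
      using convex_onD[OF assms(1) that assms(3,4)] unfolding * by simp
    \<comment> \<open>This identity turns convexity of the shifted functional into a gain
      proportional to \<open>t * (1 - t)\<close>.\<close>
    have eq: "(nrm (u + t *\<^sub>R d))\<^sup>2 = (1 - t) * (nrm u)\<^sup>2 + t * (nrm v)\<^sup>2 - t * (1 - t) * (nrm d)\<^sup>2"
      using assms unfolding nrm_sq d_def
      by (simp add: ip_lin mem ip_commute[of v u] algebra_simps)
    define A where "A = \<alpha> / 2"
    show ?thesis
      using le unfolding K_def eq A_def[symmetric] by (simp add: algebra_simps)
  qed
  have "(K has_real_derivative (F v - F u) - \<alpha> / 2 * (nrm d)\<^sup>2 - ip g d) (at 0)"
    unfolding K_def
    by (rule derivative_eq_intros gradient_at_line0[OF assms(2) d] refl | simp)+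
  moreover have "K 0 = 0"
    by (simp add: K_def)
  ultimately have "0 \<le> (F v - F u) - \<alpha> / 2 * (nrm d)\<^sup>2 - ip g d"
  proof (rule_tac ccontr)
    assume D: "(K has_real_derivative (F v - F u) - \<alpha> / 2 * (nrm d)\<^sup>2 - ip g d) (at 0)"
      and K0: "K 0 = 0" and "\<not> 0 \<le> (F v - F u) - \<alpha> / 2 * (nrm d)\<^sup>2 - ip g d"
    then obtain r where r: "0 < r" "\<And>h. 0 < h \<Longrightarrow> h < r \<Longrightarrow> K (0 + h) < K 0"
      using DERIV_neg_dec_right[OF D] by auto
    \<comment> \<open>The witness lies both in the range where \<open>K\<close> would drop below
      \<open>K 0\<close> and in the unit interval, where \<open>K\<close> is nonnegative.\<close>
    have "min (r / 2) 1 < r"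
      using r(1) by (simp add: min_def)
    then show False
      using r(2)[of "min (r / 2) 1"] r(1) K_nonneg[of "min (r / 2) 1"] K0 by auto
  qed
  then show ?thesis
    by (simp add: d_def)
qed

text \<open>Subtracting the linear and quadratic terms along the segment leaves a function whose
  derivative is nonpositive by Cauchy-Schwarz and the Lipschitz bound. Comparing its values at 0 and
  1 avoids integrating the gradient.\<close>

lemma descent_lemma:
  assumes grad: "\<And>u. u \<in> X \<Longrightarrow> gradient_at F (F' u) u"
    and lip: "\<And>u v. u \<in> X \<Longrightarrow> v \<in> X \<Longrightarrow> nrm (F' u - F' v) \<le> \<beta> * nrm (u - v)"
    and u: "u \<in> X" and d: "d \<in> X"
  shows "F (u + d) \<le> F u + ip (F' u) d + \<beta> / 2 * (nrm d)\<^sup>2"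
proof -
  define K where "K = (\<lambda>t. F (u + t *\<^sub>R d) - t * ip (F' u) d - \<beta> / 2 * t\<^sup>2 * (nrm d)\<^sup>2)"
  have F'X: "F' w \<in> X" if "w \<in> X" for w
    using grad[OF that] by (simp add: gradient_at_def)
  have "K 1 \<le> K 0"
  proof (rule DERIV_nonpos_imp_nonincreasing[where f = K])
    fix t :: real
    assume t: "0 \<le> t" "t \<le> 1"
    have w: "u + t *\<^sub>R d \<in> X"
      using u d by (simp add: mem)
    have "(K has_real_derivative ip (F' (u + t *\<^sub>R d)) d - ip (F' u) d - \<beta> * t * (nrm d)\<^sup>2) (at t)"
      unfolding K_def
      by (rule derivative_eq_intros gradient_at_line[OF grad[OF w] d] refl | simp)+
    moreover have "ip (F' (u + t *\<^sub>R d)) d - ip (F' u) d - \<beta> * t * (nrm d)\<^sup>2 \<le> 0"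
    proof -
      have "ip (F' (u + t *\<^sub>R d) - F' u) d \<le> nrm (F' (u + t *\<^sub>R d) - F' u) * nrm d"
        using Cauchy_Schwarz F'X u w d by (simp add: mem)
      also have "\<dots> \<le> \<beta> * nrm (u + t *\<^sub>R d - u) * nrm d"
        using lip[OF w u] by (intro mult_right_mono) (auto simp: nrm_nonneg)
      also have "\<dots> = \<beta> * t * (nrm d)\<^sup>2"
        using t d by (simp add: nrm_scaleR power2_eq_square)
      finally show ?thesis
        using F'X u w d by (simp add: ip_lin)
    qed
    ultimately show "\<exists>y. (K has_real_derivative y) (at t) \<and> y \<le> 0"
      by blast
  qed simp
  then show ?thesis
    by (simp add: K_def)
qed

section \<open>Legendre-Fenchel conjugates\<close>

definition conjugate :: "('a \<Rightarrow> real) \<Rightarrow> 'a \<Rightarrow> real"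
  where "conjugate F v = (SUP u\<in>X. ip u v - F u)"

text \<open>The gain at the midpoint comes from the parallelogram law; it forces maximizing
  sequences to be Cauchy in \<open>conjugate_attained\<close>.\<close>

lemma strongly_convex_midpoint:
  assumes "convex_on X (\<lambda>u. F u - \<alpha> / 2 * (nrm u)\<^sup>2)" "u \<in> X" "v \<in> X"
  shows "F ((1/2) *\<^sub>R u + (1/2) *\<^sub>R v) \<le> F u / 2 + F v / 2 - \<alpha> / 8 * (nrm (u - v))\<^sup>2"
proof -
  have "F ((1/2) *\<^sub>R u + (1/2) *\<^sub>R v) - \<alpha> / 2 * (nrm ((1/2) *\<^sub>R u + (1/2) *\<^sub>R v))\<^sup>2
      \<le> (1/2) * (F u - \<alpha> / 2 * (nrm u)\<^sup>2) + (1/2) * (F v - \<alpha> / 2 * (nrm v)\<^sup>2)"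
    using convex_onD[OF assms(1), of "1/2" u v] assms by simp
  moreover have "(nrm ((1/2) *\<^sub>R u + (1/2) *\<^sub>R v))\<^sup>2
      = (nrm u)\<^sup>2 / 2 + (nrm v)\<^sup>2 / 2 - (nrm (u - v))\<^sup>2 / 4"
    using assms unfolding nrm_sq
    by (simp add: ip_lin mem ip_commute[of v u] add_divide_distrib diff_divide_distrib)
  ultimately show ?thesis
    by (simp add: algebra_simps)
qed

text \<open>The gradient bound at 0 makes \<open>F\<close> grow quadratically, which by
  \<open>young\<close> dominates the linear term. Without boundedness the real-valued
  \<open>SUP\<close> would carry no information.\<close>

lemma conjugate_bdd_above:
  assumes "0 < \<alpha>" "convex_on X (\<lambda>u. F u - \<alpha> / 2 * (nrm u)\<^sup>2)" "gradient_at F g 0" "v \<in> X"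
  shows "bdd_above ((\<lambda>u. ip u v - F u) ` X)"
proof (rule bdd_aboveI2)
  fix u
  assume u: "u \<in> X"
  have g: "g \<in> X"
    using assms by (simp add: gradient_at_def)
  have "F 0 + ip g u + \<alpha> / 2 * (nrm u)\<^sup>2 \<le> F u"
    using strongly_convex_gradient_bound[OF assms(2,3) mem_zero u] by simp
  moreover have "ip u (v - g) \<le> \<alpha> / 2 * (nrm u)\<^sup>2 + 1 / (2 * \<alpha>) * (nrm (v - g))\<^sup>2"
    using young u assms g by (simp add: mem)
  moreover have "ip u (v - g) = ip u v - ip g u"
    using u assms g by (simp add: ip_lin ip_commute)
  ultimately show "ip u v - F u \<le> 1 / (2 * \<alpha>) * (nrm (v - g))\<^sup>2 - F 0"
    by simp
qed

text \<open>Direct method: a maximizing sequence is Cauchy, completeness gives a limit, and the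
  linear lower bound of \<open>F\<close> at that limit supplies the semicontinuity that makes it a
  maximizer.\<close>

lemma conjugate_attained:
  assumes "0 < \<alpha>" "convex_on X (\<lambda>u. F u - \<alpha> / 2 * (nrm u)\<^sup>2)"
    and grad: "\<And>u. u \<in> X \<Longrightarrow> gradient_at F (F' u) u" and v: "v \<in> X"
  obtains u where "u \<in> X" "conjugate F v = ip u v - F u" "\<And>w. w \<in> X \<Longrightarrow> ip w v - F w \<le> ip u v - F u"
proof -
  define \<Phi> where "\<Phi> = (\<lambda>u. ip u v - F u)"
  define S where "S = conjugate F v"
  have bdd: "bdd_above (\<Phi> ` X)"
    unfolding \<Phi>_def using conjugate_bdd_above[OF assms(1,2) grad[OF mem_zero] v] .
  have \<Phi>_le: "\<Phi> w \<le> S" if "w \<in> X" for w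
    unfolding S_def conjugate_def \<Phi>_def[symmetric] using that bdd by (rule cSUP_upper)
  have "\<exists>u\<in>X. S - 1 / real (Suc n) < \<Phi> u" for n
  proof -
    have "S - 1 / real (Suc n) < (SUP u\<in>X. \<Phi> u)"
      by (simp add: S_def conjugate_def \<Phi>_def)
    then show ?thesis
      using less_cSUP_iff[OF _ bdd] mem_zero by blast
  qed
  then obtain s where s: "\<And>n. s n \<in> X" "\<And>n. S - 1 / real (Suc n) < \<Phi> (s n)"
    by metis
  \<comment> \<open>The value at the midpoint cannot exceed \<open>S\<close>, while both ends are
    within \<open>1 / real (Suc M)\<close> of it, so the strong convexity gain has no more room than
    that.\<close>
  have close: "\<alpha> / 8 * (nrm (s m - s n))\<^sup>2 \<le> 1 / real (Suc M)" if "M \<le> m" "M \<le> n" for m n M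
  proof -
    let ?z = "(1/2) *\<^sub>R s m + (1/2) *\<^sub>R s n"
    have z: "?z \<in> X"
      using s by (simp add: mem)
    have "1 / real (Suc m) \<le> 1 / real (Suc M)" "1 / real (Suc n) \<le> 1 / real (Suc M)"
      using that by (auto simp: field_simps)
    moreover have "ip ?z v = ip (s m) v / 2 + ip (s n) v / 2"
      using s v by (simp add: ip_lin mem)
    moreover note \<Phi>_le[OF z] strongly_convex_midpoint[OF assms(2) s(1)[of m] s(1)[of n]]
      s(2)[of m] s(2)[of n]
    ultimately show ?thesis
      unfolding \<Phi>_def by simp
  qed
  have "\<exists>M. \<forall>m\<ge>M. \<forall>n\<ge>M. nrm (s m - s n) < \<epsilon>" if "0 < \<epsilon>" for \<epsilon> :: real
  proof -
    obtain M where M: "1 / real (Suc M) < \<alpha> / 8 * \<epsilon>\<^sup>2"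
      using \<open>0 < \<epsilon>\<close> assms(1) by (rule_tac nat_approx_posE[of "\<alpha> / 8 * \<epsilon>\<^sup>2"]) simp
    have "nrm (s m - s n) < \<epsilon>" if "M \<le> m" "M \<le> n" for m n
    proof -
      have "\<alpha> / 8 * (nrm (s m - s n))\<^sup>2 < \<alpha> / 8 * \<epsilon>\<^sup>2"
        using close[OF that] M by simp
      then have "(nrm (s m - s n))\<^sup>2 < \<epsilon>\<^sup>2"
        using assms(1) by simp
      then show ?thesis
        using \<open>0 < \<epsilon>\<close> by (simp add: power2_less_imp_less)
    qed
    then show ?thesis
      by blast
  qed
  then obtain l where l: "l \<in> X" "(\<lambda>n. nrm (s n - l)) \<longlonglongrightarrow> 0"
    using complete[of s] s(1) by blast
  have F'l: "F' l \<in> X"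
    using grad[OF l(1)] by (simp add: gradient_at_def)
  have "\<Phi> (s n) \<le> \<Phi> l + nrm (s n - l) * nrm (v - F' l)" for n
  proof -
    have "F l + ip (F' l) (s n - l) + \<alpha> / 2 * (nrm (s n - l))\<^sup>2 \<le> F (s n)"
      using strongly_convex_gradient_bound[OF assms(2) grad[OF l(1)] l(1) s(1)] .
    moreover have "0 \<le> \<alpha> / 2 * (nrm (s n - l))\<^sup>2"
      using assms(1) by simp
    moreover have "ip (s n - l) (v - F' l) \<le> nrm (s n - l) * nrm (v - F' l)"
      using Cauchy_Schwarz s l v F'l by (simp add: mem)
    moreover have "ip (s n - l) (v - F' l) = ip (s n) v - ip l v - ip (F' l) (s n - l)"
      using s(1)[of n] l(1) v F'l by (simp add: ip_lin mem ip_commute[of _ "F' l"])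
    ultimately show ?thesis
      by (simp add: \<Phi>_def)
  qed
  then have "S - 1 / real (Suc n) \<le> \<Phi> l + nrm (s n - l) * nrm (v - F' l)" for n
    using s(2)[of n] by (meson less_imp_le order_trans)
  moreover have "(\<lambda>n. S - 1 / real (Suc n)) \<longlonglongrightarrow> S - 0"
    using LIMSEQ_inverse_real_of_nat by (intro tendsto_intros) (simp add: inverse_eq_divide)
  moreover have "(\<lambda>n. \<Phi> l + nrm (s n - l) * nrm (v - F' l)) \<longlonglongrightarrow> \<Phi> l + 0 * nrm (v - F' l)"
    using l(2) by (intro tendsto_intros)
  ultimately have "S \<le> \<Phi> l"
    using LIMSEQ_le[of "\<lambda>n. S - 1 / real (Suc n)" "S - 0"
        "\<lambda>n. \<Phi> l + nrm (s n - l) * nrm (v - F' l)" "\<Phi> l + 0 * nrm (v - F' l)"] by auto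
  then have "S = \<Phi> l"
    using \<Phi>_le[OF l(1)] by simp
  then show ?thesis
    using that[OF l(1)] \<Phi>_le unfolding S_def \<Phi>_def by metis
qed

text \<open>The maximizer \<open>g\<close> of the supremum at \<open>v\<close> acts as gradient of
  the conjugate there. Smoothness of \<open>F\<close> at \<open>g\<close> bounds the supremum at
  \<open>w\<close> from below through one test point; strong convexity of \<open>F\<close> at
  \<open>g\<close> together with \<open>young\<close> bounds every competitor from above.\<close>

lemma conjugate_quadratic_bounds:
  assumes pos: "0 < \<alpha>" "0 < \<beta>" and conv: "convex_on X (\<lambda>u. F u - \<alpha> / 2 * (nrm u)\<^sup>2)"
    and grad: "\<And>u. u \<in> X \<Longrightarrow> gradient_at F (F' u) u"
    and lip: "\<And>u v. u \<in> X \<Longrightarrow> v \<in> X \<Longrightarrow> nrm (F' u - F' v) \<le> \<beta> * nrm (u - v)"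
    and v: "v \<in> X"
  obtains g where "g \<in> X"
    "\<And>w. w \<in> X \<Longrightarrow> conjugate F v + ip g (w - v) + 1 / (2 * \<beta>) * (nrm (w - v))\<^sup>2 \<le> conjugate F w"
    "\<And>w. w \<in> X \<Longrightarrow> conjugate F w \<le> conjugate F v + ip g (w - v) + 1 / (2 * \<alpha>) * (nrm (w - v))\<^sup>2"
proof -
  obtain g where g: "g \<in> X" "conjugate F v = ip g v - F g"
    and max: "\<And>w. w \<in> X \<Longrightarrow> ip w v - F w \<le> ip g v - F g"
    using conjugate_attained[OF pos(1) conv grad v] by blast
  have F'g: "F' g \<in> X"
    using grad[OF g(1)] by (simp add: gradient_at_def)
  \<comment> \<open>First order optimality of \<open>g\<close>. It is expressed by pairings because
    a semidefinite form does not give \<open>F' g = v\<close>.\<close>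
  have stationary: "ip (F' g) d = ip v d" if d: "d \<in> X" for d
  proof -
    define K where "K = (\<lambda>t. ip (g + t *\<^sub>R d) v - F (g + t *\<^sub>R d))"
    have "K = (\<lambda>t. ip g v + t * ip d v - F (g + t *\<^sub>R d))"
      using g d v by (simp add: K_def ip_lin mem)
    then have "(K has_real_derivative ip d v - ip (F' g) d) (at 0)"
      by (auto intro!: derivative_eq_intros gradient_at_line0[OF grad[OF g(1)] d])
    moreover have "\<forall>y. \<bar>0 - y\<bar> < 1 \<longrightarrow> K y \<le> K 0"
      using max g d by (simp add: K_def mem)
    ultimately have "ip d v - ip (F' g) d = 0"
      using DERIV_local_max[of K "ip d v - ip (F' g) d" 0 1] by (metis zero_less_one)
    then show ?thesis
      by (simp add: ip_commute)
  qed
  show thesis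
  proof (rule that[OF g(1)])
    fix w
    assume w: "w \<in> X"
    define d where "d = w - v"
    have d: "d \<in> X"
      using w v by (simp add: d_def mem)
    have bdd: "bdd_above ((\<lambda>u. ip u w - F u) ` X)"
      using conjugate_bdd_above[OF pos(1) conv grad[OF mem_zero] w] .
    have wd: "ip u w = ip u v + ip u d" if "u \<in> X" for u
      using that w v by (simp add: d_def ip_lin)
    \<comment> \<open>The best test point for the descent lemma:
      \<open>ip e d - \<beta> / 2 * (nrm e)\<^sup>2\<close> is maximal at
      \<open>e = (1 / \<beta>) *\<^sub>R d\<close>.\<close>
    let ?u = "g + (1 / \<beta>) *\<^sub>R d"
    have u: "?u \<in> X"
      using g d by (simp add: mem)
    have "F ?u \<le> F g + ip (F' g) ((1 / \<beta>) *\<^sub>R d) + \<beta> / 2 * (nrm ((1 / \<beta>) *\<^sub>R d))\<^sup>2"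
      using descent_lemma[OF grad lip] g d by (simp add: mem)
    also have "ip (F' g) ((1 / \<beta>) *\<^sub>R d) = ip v d / \<beta>"
      using stationary[of "(1 / \<beta>) *\<^sub>R d"] d v by (simp add: mem ip_lin)
    also have "\<beta> / 2 * (nrm ((1 / \<beta>) *\<^sub>R d))\<^sup>2 = ip d d / (2 * \<beta>)"
      using pos d by (simp add: nrm_sq ip_lin mem)
    finally have "F ?u \<le> F g + ip v d / \<beta> + ip d d / (2 * \<beta>)" .
    moreover have "ip ?u w = ip g v + ip g d + ip v d / \<beta> + ip d d / \<beta>"
      using g d v wd u by (simp add: ip_lin mem ip_commute[of d v] add_divide_distrib)
    moreover have "ip ?u w - F ?u \<le> conjugate F w"
      unfolding conjugate_def using u bdd by (rule cSUP_upper)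
    moreover have "ip d d / \<beta> = ip d d / (2 * \<beta>) + ip d d / (2 * \<beta>)"
      by (simp add: field_simps)
    ultimately show "conjugate F v + ip g (w - v) + 1 / (2 * \<beta>) * (nrm (w - v))\<^sup>2 \<le> conjugate F w"
      using g(2) unfolding d_def[symmetric] nrm_sq times_divide_eq_left mult_1 by linarith
    show "conjugate F w \<le> conjugate F v + ip g (w - v) + 1 / (2 * \<alpha>) * (nrm (w - v))\<^sup>2"
      unfolding conjugate_def[of F w]
    proof (rule cSUP_least)
      show "X \<noteq> {}"
        using mem_zero by blast
      fix u
      assume u: "u \<in> X"
      have "F g + ip (F' g) (u - g) + \<alpha> / 2 * (nrm (u - g))\<^sup>2 \<le> F u"
        using strongly_convex_gradient_bound[OF conv grad[OF g(1)] g(1) u] .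
      moreover have "ip (F' g) (u - g) = ip u v - ip g v"
        using stationary[of "u - g"] u g v by (simp add: mem ip_lin ip_commute[of v])
      moreover have "ip (u - g) d \<le> \<alpha> / 2 * (nrm (u - g))\<^sup>2 + 1 / (2 * \<alpha>) * (nrm d)\<^sup>2"
        using young u g d pos by (simp add: mem)
      moreover have "ip (u - g) d = ip u d - ip g d"
        using u g d by (simp add: ip_lin)
      ultimately show "ip u w - F u \<le> conjugate F v + ip g (w - v) + 1 / (2 * \<alpha>) * (nrm (w - v))\<^sup>2"
        using g wd[OF u] unfolding d_def[symmetric] by simp
    qed
  qed
qed

end

section \<open>Square integrable functions and the space of piecewise constant functions\<close>

lemma fun_scaleR_apply [simp]: "(c *\<^sub>R f) x = c *\<^sub>R f x"
  by (simp add: scaleR_fun_def)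

lemma sum_fun_apply: "(\<Sum>k\<in>K. f k) x = (\<Sum>k\<in>K. f k x :: 'a::comm_monoid_add)"
  by (induction K rule: infinite_finite_induct) auto

lemma square_integrable_add:
  assumes "square_integrable \<Omega> f" "square_integrable \<Omega> g"
  shows "square_integrable \<Omega> (f + g)"
  unfolding square_integrable_def
proof
  have meas: "set_borel_measurable lborel \<Omega> f" "set_borel_measurable lborel \<Omega> g"
    using assms by (auto simp: square_integrable_def)
  show sum: "set_borel_measurable lborel \<Omega> (f + g)"
    using borel_measurable_add[OF meas[unfolded set_borel_measurable_def]]
    by (simp add: set_borel_measurable_def scaleR_add_right)
  show "set_integrable lborel \<Omega> (\<lambda>x. (norm ((f + g) x))\<^sup>2)"
  proof (rule set_integrable_bound)
    show "set_integrable lborel \<Omega> (\<lambda>x. 2 * (norm (f x))\<^sup>2 + 2 * (norm (g x))\<^sup>2)"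
      using assms by (auto simp: square_integrable_def)
    have "(\<lambda>x. (norm (indicator \<Omega> x *\<^sub>R (f + g) x))\<^sup>2) \<in> borel_measurable lborel"
      using sum unfolding set_borel_measurable_def by measurable
    moreover have "(\<lambda>x. (norm (indicator \<Omega> x *\<^sub>R (f + g) x))\<^sup>2)
        = (\<lambda>x. indicator \<Omega> x *\<^sub>R (norm ((f + g) x))\<^sup>2)"
      by (auto simp: indicator_def)
    ultimately show "set_borel_measurable lborel \<Omega> (\<lambda>x. (norm ((f + g) x))\<^sup>2)"
      by (simp add: set_borel_measurable_def)
    have "(norm (f x + g x))\<^sup>2 \<le> 2 * (norm (f x))\<^sup>2 + 2 * (norm (g x))\<^sup>2" for x
    proof -
      have "(norm (f x + g x))\<^sup>2 \<le> (norm (f x) + norm (g x))\<^sup>2"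
        by (intro power_mono norm_triangle_ineq) auto
      also have "\<dots> \<le> 2 * (norm (f x))\<^sup>2 + 2 * (norm (g x))\<^sup>2"
        using sum_squares_bound[of "norm (f x)" "norm (g x)"] by (simp add: power2_sum)
      finally show ?thesis .
    qed
    then show "AE x in lborel. x \<in> \<Omega> \<longrightarrow> norm ((norm ((f + g) x))\<^sup>2)
        \<le> norm (2 * (norm (f x))\<^sup>2 + 2 * (norm (g x))\<^sup>2)"
      by simp
  qed
qed

lemma square_integrable_scaleR:
  assumes "square_integrable \<Omega> f"
  shows "square_integrable \<Omega> (c *\<^sub>R f)"
  unfolding square_integrable_def
proof
  have "(\<lambda>x. c *\<^sub>R (indicator \<Omega> x *\<^sub>R f x)) \<in> borel_measurable lborel"
    using assms unfolding square_integrable_def set_borel_measurable_def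
    by (intro borel_measurable_const_scaleR) simp
  then show "set_borel_measurable lborel \<Omega> (c *\<^sub>R f)"
    by (simp add: set_borel_measurable_def mult.commute)
  show "set_integrable lborel \<Omega> (\<lambda>x. (norm ((c *\<^sub>R f) x))\<^sup>2)"
    using assms by (simp add: square_integrable_def power_mult_distrib)
qed

lemma square_integrable_zero: "square_integrable \<Omega> 0"
  by (simp add: square_integrable_def set_borel_measurable_def set_integrable_def)

lemma square_integrable_sum:
  assumes "\<And>k. k \<in> K \<Longrightarrow> square_integrable \<Omega> (f k)"
  shows "square_integrable \<Omega> (\<Sum>k\<in>K. f k)"
  using assms
  by (induction K rule: infinite_finite_induct)
    (auto simp: square_integrable_zero square_integrable_add)

lemma square_integrable_inner:
  assumes "square_integrable \<Omega> f" "square_integrable \<Omega> g"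
  shows "set_integrable lborel \<Omega> (\<lambda>x. f x \<bullet> g x)"
proof (rule set_integrable_bound)
  show "set_integrable lborel \<Omega> (\<lambda>x. (norm (f x))\<^sup>2 + (norm (g x))\<^sup>2)"
    using assms by (auto simp: square_integrable_def)
  have "(\<lambda>x. (indicator \<Omega> x *\<^sub>R f x) \<bullet> (indicator \<Omega> x *\<^sub>R g x)) \<in> borel_measurable lborel"
    using assms unfolding square_integrable_def set_borel_measurable_def
    by (intro borel_measurable_inner) auto
  moreover have "(\<lambda>x. (indicator \<Omega> x *\<^sub>R f x) \<bullet> (indicator \<Omega> x *\<^sub>R g x))
      = (\<lambda>x. indicator \<Omega> x *\<^sub>R (f x \<bullet> g x))"
    by (auto simp: indicator_def)
  ultimately show "set_borel_measurable lborel \<Omega> (\<lambda>x. f x \<bullet> g x)"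
    by (simp add: set_borel_measurable_def)
  have "\<bar>f x \<bullet> g x\<bar> \<le> (norm (f x))\<^sup>2 + (norm (g x))\<^sup>2" for x
  proof -
    have "2 * \<bar>f x \<bullet> g x\<bar> \<le> (norm (f x))\<^sup>2 + (norm (g x))\<^sup>2"
      using Cauchy_Schwarz_ineq2[of "f x" "g x"] sum_squares_bound[of "norm (f x)" "norm (g x)"]
      by simp
    then show ?thesis
      using abs_ge_zero[of "f x \<bullet> g x"] by linarith
  qed
  then show "AE x in lborel. x \<in> \<Omega> \<longrightarrow> norm (f x \<bullet> g x) \<le> norm ((norm (f x))\<^sup>2 + (norm (g x))\<^sup>2)"
    by simp
qed

lemma square_integrable_continuous:
  fixes f :: "point \<Rightarrow> 'b::euclidean_space"
  assumes "bounded \<Omega>" "\<Omega> \<in> sets borel" "continuous_on UNIV f"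
  shows "square_integrable \<Omega> f"
  unfolding square_integrable_def
proof
  have [measurable]: "f \<in> borel_measurable borel"
    using assms(3) by (rule borel_measurable_continuous_onI)
  show "set_borel_measurable lborel \<Omega> f"
    using assms(2) unfolding set_borel_measurable_def by measurable
  have "compact (closure \<Omega>)"
    using assms(1) by (simp add: compact_closure)
  then have "set_integrable lborel (closure \<Omega>) (\<lambda>x. (norm (f x))\<^sup>2)"
    unfolding set_integrable_def
    by (rule borel_integrable_compact) (intro continuous_intros continuous_on_subset[OF assms(3)], simp)
  then show "set_integrable lborel \<Omega> (\<lambda>x. (norm (f x))\<^sup>2)"
    by (rule set_integrable_subset) (use assms(2) in \<open>auto simp: closure_subset\<close>)
qed

lemma square_integrable_indicator:
  assumes "bounded T" "T \<in> sets borel" "\<Omega> \<in> sets borel"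
  shows "square_integrable \<Omega> (\<lambda>x. c * indicator T x :: real)"
  unfolding square_integrable_def
proof
  show "set_borel_measurable lborel \<Omega> (\<lambda>x. c * indicator T x)"
    using assms unfolding set_borel_measurable_def by measurable
  have "integrable lborel (indicator (T \<inter> \<Omega>) :: point \<Rightarrow> real)"
    using assms bounded_subset[OF assms(1), of "T \<inter> \<Omega>"]
    by (intro integrable_real_indicator) (auto dest: emeasure_bounded_finite)
  then have "integrable lborel (\<lambda>x. c\<^sup>2 * indicator (T \<inter> \<Omega>) x)"
    by simp
  moreover have "(\<lambda>x. c\<^sup>2 * indicator (T \<inter> \<Omega>) x)
      = (\<lambda>x. indicator \<Omega> x *\<^sub>R (norm (c * indicator T x :: real))\<^sup>2)"
    by (auto simp: indicator_def)
  ultimately show "set_integrable lborel \<Omega> (\<lambda>x. (norm (c * indicator T x :: real))\<^sup>2)"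
    by (simp add: set_integrable_def)
qed

section \<open>Geometry of the grid and coordinates on the piecewise constant space\<close>

locale grid =
  fixes m1 m2 :: nat and h :: real
  assumes h_pos: "0 < h"
begin

abbreviation "\<Omega> \<equiv> domain m1 m2 h"
abbreviation "elems \<equiv> elements m1 m2 h"
abbreviation "X \<equiv> X_h m1 m2 h"
abbreviation "Y \<equiv> Y_h m1 m2 h"
abbreviation "C \<equiv> C_h m1 m2 h"

lemma open_domain: "open \<Omega>"
  by (simp add: domain_def open_Times)

lemma borel_domain: "\<Omega> \<in> sets borel"
  using open_domain by simp

lemma bounded_domain: "bounded \<Omega>"
  unfolding domain_def by (intro bounded_Times) auto

lemma open_cell: "open (cell h i j)"
  by (simp add: cell_def open_Times)

lemma bounded_cell: "bounded (cell h i j)"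
  unfolding cell_def by (intro bounded_Times) auto

lemma cell_nonempty: "cell h i j \<noteq> {}"
  using h_pos by (auto simp: cell_def)

lemma cell_disjoint:
  assumes "x \<in> cell h i j" "x \<in> cell h k l"
  shows "i = k \<and> j = l"
proof -
  have "a = b" if "real a * h < t" "t < real (Suc a) * h" "real b * h < t" "t < real (Suc b) * h"
    for a b :: nat and t :: real
  proof -
    have "real a * h < real (Suc b) * h" "real b * h < real (Suc a) * h"
      using that by linarith+
    then have "a < Suc b" "b < Suc a"
      using h_pos by (auto simp only: mult_less_cancel_right_pos of_nat_less_iff)
    then show ?thesis
      by simp
  qed
  from this[of i "fst x" k] this[of j "snd x" l] show ?thesis
    using assms by (auto simp: cell_def mem_Times_iff)
qed

lemma elements_disjoint:
  assumes "S \<in> elems" "T \<in> elems" "x \<in> S" "x \<in> T"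
  shows "S = T"
proof -
  obtain i j k l where "S = cell h i j" "T = cell h k l"
    using assms(1,2) unfolding elements_def by blast
  then show ?thesis
    using assms(3,4) cell_disjoint[of x i j k l] by simp
qed

lemma elements_eq_image: "elems = (\<lambda>(i, j). cell h i j) ` ({..<m1} \<times> {..<m2})"
  by (auto simp: elements_def)

lemma finite_elements: "finite elems"
  by (simp add: elements_eq_image)

lemma elements_properties:
  assumes "T \<in> elems"
  shows "open T" "bounded T" "T \<noteq> {}" "T \<in> sets borel"
  using assms open_cell bounded_cell cell_nonempty by (auto simp: elements_def)

lemma cell_subset_domain:
  assumes "i < m1" "j < m2"
  shows "cell h i j \<subseteq> \<Omega>"
proof -
  have "0 \<le> real i * h" "real (Suc i) * h \<le> real m1 * h"
    "0 \<le> real j * h" "real (Suc j) * h \<le> real m2 * h"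
    using assms h_pos by (simp_all del: of_nat_Suc add: mult_right_mono)
  then show ?thesis
    unfolding cell_def domain_def
    by (intro Sigma_mono) (simp_all only: greaterThanLessThan_subseteq_greaterThanLessThan, blast+)
qed

lemma element_subset_domain: "T \<in> elems \<Longrightarrow> T \<subseteq> \<Omega>"
  using cell_subset_domain by (auto simp: elements_def)

text \<open>Inverse to reading off element values; limits in \<open>X\<close> and discrete
  divergences are built with it. The elements are pairwise disjoint, so at each of their points only
  one indicator is nonzero.\<close>

definition piecewise :: "(point set \<Rightarrow> real) \<Rightarrow> scalar_field"
  where "piecewise c = (\<Sum>T\<in>elems. (\<lambda>x. c T * indicator T x))"

lemma piecewise_eq:
  assumes "T \<in> elems" "x \<in> T"
  shows "piecewise c x = c T"
proof -
  have "piecewise c x = (\<Sum>S\<in>elems. c S * indicator S x)"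
    by (simp add: piecewise_def sum_fun_apply)
  also have "\<dots> = (\<Sum>S\<in>elems. if S = T then c T else 0)"
  proof (rule sum.cong)
    show "c S * indicator S x = (if S = T then c T else 0)" if "S \<in> elems" for S
    proof (cases "x \<in> S")
      case True
      then show ?thesis
        using elements_disjoint[OF that assms(1) _ assms(2)] by simp
    next
      case False
      then have "S \<noteq> T"
        using assms(2) by blast
      then show ?thesis
        using False by simp
    qed
  qed simp
  finally show ?thesis
    using assms finite_elements by simp
qed

lemma piecewise_outside:
  assumes "x \<notin> \<Union>elems"
  shows "piecewise c x = 0"
proof -
  have "piecewise c x = (\<Sum>S\<in>elems. c S * indicator S x)"
    by (simp add: piecewise_def sum_fun_apply)
  also have "\<dots> = 0"
    using assms by (intro sum.neutral) (auto simp: indicator_def)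
  finally show ?thesis .
qed

lemma piecewise_mem: "piecewise c \<in> X"
  unfolding X_h_def
proof (intro CollectI conjI ballI)
  show "square_integrable \<Omega> (piecewise c)"
    unfolding piecewise_def using elements_properties
    by (intro square_integrable_sum square_integrable_indicator borel_domain)
  show "normalized m1 m2 h (piecewise c)"
    by (simp add: normalized_def piecewise_outside)
  show "\<exists>d. \<forall>x\<in>T. piecewise c x = d" if "T \<in> elems" for T
    using piecewise_eq[OF that] by blast
qed

lemma value_on_eqI:
  assumes "T \<in> elems" "\<And>x. x \<in> T \<Longrightarrow> u x = c"
  shows "value_on u T = c"
proof -
  obtain y where "y \<in> T"
    using elements_properties(3)[OF assms(1)] by blast
  then show ?thesis
    unfolding value_on_def using assms(2) by (intro the_equality) auto
qed

lemma value_on_eq: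
  assumes "u \<in> X" "T \<in> elems" "x \<in> T"
  shows "u x = value_on u T"
proof -
  obtain c where "\<And>x. x \<in> T \<Longrightarrow> u x = c"
    using assms unfolding X_h_def by blast
  then show ?thesis
    using assms value_on_eqI[of T u c] by simp
qed

text \<open>Normalization forces the value 0 off the open elements, so the element values leave no
  freedom.\<close>

lemma X_eqI:
  assumes "u \<in> X" "v \<in> X" "\<And>T. T \<in> elems \<Longrightarrow> value_on u T = value_on v T"
  shows "u = v"
proof
  fix x
  show "u x = v x"
  proof (cases "x \<in> \<Union>elems")
    case True
    then obtain T where "T \<in> elems" "x \<in> T"
      by blast
    then show ?thesis
      using assms by (simp add: value_on_eq)
  next
    case False
    have "normalized m1 m2 h u" "normalized m1 m2 h v"
      using assms(1,2) by (auto simp: X_h_def)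
    then show ?thesis
      using False unfolding normalized_def by metis
  qed
qed

lemma subspace_X: "subspace X"
  unfolding subspace_def
proof (intro conjI ballI allI)
  show "0 \<in> X"
    by (simp add: X_h_def square_integrable_zero normalized_def)
next
  fix u v
  assume "u \<in> X" "v \<in> X"
  then show "u + v \<in> X"
    by (auto simp: X_h_def square_integrable_add normalized_def) metis
next
  fix c u
  assume "u \<in> X"
  then show "c *\<^sub>R u \<in> X"
    by (auto simp: X_h_def square_integrable_scaleR normalized_def)
qed

lemma value_on_add:
  "\<lbrakk>u \<in> X; v \<in> X; T \<in> elems\<rbrakk> \<Longrightarrow> value_on (u + v) T = value_on u T + value_on v T"
  by (rule value_on_eqI) (auto simp: value_on_eq)

lemma value_on_diff:
  "\<lbrakk>u \<in> X; v \<in> X; T \<in> elems\<rbrakk> \<Longrightarrow> value_on (u - v) T = value_on u T - value_on v T"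
  by (rule value_on_eqI) (auto simp: value_on_eq)

lemma value_on_scaleR: "\<lbrakk>u \<in> X; T \<in> elems\<rbrakk> \<Longrightarrow> value_on (c *\<^sub>R u) T = c * value_on u T"
  by (rule value_on_eqI) (auto simp: value_on_eq)

lemma value_on_piecewise: "T \<in> elems \<Longrightarrow> value_on (piecewise c) T = c T"
  by (rule value_on_eqI) (auto simp: piecewise_eq)

text \<open>The squared value on one element is a summand of the squared norm. Through this bound a
  Cauchy sequence in norm has Cauchy coordinates.\<close>

lemma value_on_le_norm_X:
  assumes "T \<in> elems"
  shows "h * \<bar>value_on u T\<bar> \<le> norm_X m1 m2 h u"
  unfolding norm_X_def
proof (rule real_le_rsqrt)
  have "(value_on u T)\<^sup>2 \<le> (\<Sum>T\<in>elems. (value_on u T)\<^sup>2)"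
    using assms finite_elements by (intro member_le_sum) auto
  then show "(h * \<bar>value_on u T\<bar>)\<^sup>2 \<le> inner_X m1 m2 h u u"
    by (simp add: inner_X_def power_mult_distrib mult_left_mono flip: power2_eq_square)
qed

text \<open>There are finitely many coordinates: each converges, \<open>piecewise\<close> assembles
  the limits, and the norm is a continuous expression in the coordinates.\<close>

lemma X_complete:
  assumes "\<And>n. s n \<in> X" and Cauchy: "\<forall>\<epsilon>>0. \<exists>M. \<forall>m\<ge>M. \<forall>n\<ge>M. norm_X m1 m2 h (s m - s n) < \<epsilon>"
  shows "\<exists>l\<in>X. (\<lambda>n. norm_X m1 m2 h (s n - l)) \<longlonglongrightarrow> 0"
proof -
  have "convergent (\<lambda>n. value_on (s n) T)" if T: "T \<in> elems" for T
  proof (rule Cauchy_convergent, rule CauchyI)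
    fix e :: real
    assume "0 < e"
    then obtain M where M: "\<And>m n. m \<ge> M \<Longrightarrow> n \<ge> M \<Longrightarrow> norm_X m1 m2 h (s m - s n) < h * e"
      using Cauchy h_pos mult_pos_pos by metis
    have "norm (value_on (s m) T - value_on (s n) T) < e" if "m \<ge> M" "n \<ge> M" for m n
    proof -
      have "h * \<bar>value_on (s m - s n) T\<bar> < h * e"
        using value_on_le_norm_X[OF T] M[OF that] by (rule le_less_trans)
      then show ?thesis
        using h_pos T assms(1) by (simp add: value_on_diff)
    qed
    then show "\<exists>M. \<forall>m\<ge>M. \<forall>n\<ge>M. norm (value_on (s m) T - value_on (s n) T) < e"
      by blast
  qed
  then have lim: "(\<lambda>n. value_on (s n) T) \<longlonglongrightarrow> lim (\<lambda>n. value_on (s n) T)" if "T \<in> elems" for T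
    using that by (simp add: convergent_LIMSEQ_iff)
  define l where "l = piecewise (\<lambda>T. lim (\<lambda>n. value_on (s n) T))"
  have l: "l \<in> X"
    by (simp add: l_def piecewise_mem)
  have "norm_X m1 m2 h (s n - l)
      = sqrt (h\<^sup>2 * (\<Sum>T\<in>elems. (value_on (s n) T - lim (\<lambda>n. value_on (s n) T))\<^sup>2))" for n
    using l assms(1)
    by (simp add: norm_X_def inner_X_def value_on_diff power2_eq_square)
      (simp add: l_def value_on_piecewise)
  moreover have "(\<lambda>n. sqrt (h\<^sup>2 * (\<Sum>T\<in>elems. (value_on (s n) T - lim (\<lambda>n. value_on (s n) T))\<^sup>2)))
      \<longlonglongrightarrow> sqrt (h\<^sup>2 * (\<Sum>T\<in>elems. (lim (\<lambda>n. value_on (s n) T) - lim (\<lambda>n. value_on (s n) T))\<^sup>2))"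
    by (intro tendsto_intros lim)
  ultimately show ?thesis
    using l by (intro bexI[of _ l]) simp_all
qed

sublocale X: complete_inner_subspace X "inner_X m1 m2 h" "norm_X m1 m2 h"
proof
  show "subspace X"
    by (rule subspace_X)
  show "inner_X m1 m2 h u v = inner_X m1 m2 h v u" for u v
    by (simp add: inner_X_def mult.commute)
  show "inner_X m1 m2 h (u + v) w = inner_X m1 m2 h u w + inner_X m1 m2 h v w"
    if "u \<in> X" "v \<in> X" "w \<in> X" for u v w
    using that by (simp add: inner_X_def value_on_add algebra_simps sum.distrib)
  show "inner_X m1 m2 h (c *\<^sub>R u) w = c * inner_X m1 m2 h u w" if "u \<in> X" "w \<in> X" for u w c
    using that by (simp add: inner_X_def value_on_scaleR sum_distrib_left mult_ac)
  show "0 \<le> inner_X m1 m2 h u u" for u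
    by (simp add: inner_X_def sum_nonneg)
  show "norm_X m1 m2 h u = sqrt (inner_X m1 m2 h u u)" for u
    by (simp add: norm_X_def)
  show "\<exists>l\<in>X. (\<lambda>n. norm_X m1 m2 h (s n - l)) \<longlonglongrightarrow> 0"
    if "\<And>n. s n \<in> X" "\<forall>\<epsilon>>0. \<exists>M. \<forall>m\<ge>M. \<forall>n\<ge>M. norm_X m1 m2 h (s m - s n) < \<epsilon>" for s
    using X_complete that .
qed

end

section \<open>The weak divergence of Raviart--Thomas fields\<close>

lemma DERIV_positive_part_square: "((\<lambda>s::real. (max 0 s)\<^sup>2) has_real_derivative 2 * max 0 s) (at s)"
  unfolding DERIV_def
proof (rule LIM_I)
  fix e :: real
  assume "0 < e"
  \<comment> \<open>Squaring removes the kink of the positive part at 0: in every sign pattern of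
    \<open>s\<close> and \<open>s + t\<close> the error is at most quadratic in
    \<open>t\<close>.\<close>
  have "\<bar>((max 0 (s + t))\<^sup>2 - (max 0 s)\<^sup>2) / t - 2 * max 0 s\<bar> \<le> \<bar>t\<bar>" if "t \<noteq> 0" for t
  proof -
    have "\<bar>(max 0 (s + t))\<^sup>2 - (max 0 s)\<^sup>2 - 2 * max 0 s * t\<bar> \<le> t\<^sup>2"
    proof -
      consider "0 \<le> s" "0 \<le> s + t" | "0 \<le> s" "s + t < 0" | "s < 0" "0 \<le> s + t" | "s < 0" "s + t < 0"
        by linarith
      then show ?thesis
      proof cases
        case 1
        then show ?thesis
          by (simp add: max_def power2_eq_square algebra_simps)
      next
        case 2
        have "- s\<^sup>2 - 2 * s * t = t\<^sup>2 - (s + t)\<^sup>2"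
          by (simp add: power2_eq_square algebra_simps)
        moreover have "(s + t)\<^sup>2 \<le> t\<^sup>2"
          using 2 by (intro abs_le_square_iff[THEN iffD1]) auto
        ultimately show ?thesis
          using 2 by (simp add: max_def)
      next
        case 3
        have "(s + t)\<^sup>2 \<le> t\<^sup>2"
          using 3 by (intro power_mono) auto
        then show ?thesis
          using 3 by (simp add: max_def)
      next
        case 4
        then show ?thesis
          by (simp add: max_def)
      qed
    qed
    then have "\<bar>(max 0 (s + t))\<^sup>2 - (max 0 s)\<^sup>2 - 2 * max 0 s * t\<bar> / \<bar>t\<bar> \<le> \<bar>t\<bar>"
      using that by (simp add: divide_le_eq power2_eq_square)
    then show ?thesis
      using that by (simp add: diff_divide_distrib flip: abs_divide)
  qed
  then show "\<exists>r>0. \<forall>t. t \<noteq> 0 \<and> norm (t - 0) < r \<longrightarrow>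
      norm (((max 0 (s + t))\<^sup>2 - (max 0 s)\<^sup>2) / t - 2 * max 0 s) < e"
    using \<open>0 < e\<close> by (intro exI[of _ e]) (auto intro: le_less_trans)
qed

text \<open>These are \<open>C\<^sup>1\<close>, have compact support in \<open>(a, b)\<close> for \<open>a < b\<close>, and converge boundedly to the indicator
  function of \<open>(a, b)\<close>, which makes products of them test functions for the integral over a box.\<close>

definition bump :: "real \<Rightarrow> real \<Rightarrow> nat \<Rightarrow> real \<Rightarrow> real"
  where "bump a b n t = (let s = real n * ((t - a) * (b - t)) - 1 in (max 0 s)\<^sup>2 / (1 + (max 0 s)\<^sup>2))"

definition bump' :: "real \<Rightarrow> real \<Rightarrow> nat \<Rightarrow> real \<Rightarrow> real"
  where "bump' a b n t = (let s = real n * ((t - a) * (b - t)) - 1 in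
    2 * max 0 s / (1 + (max 0 s)\<^sup>2)\<^sup>2 * (real n * (a + b - 2 * t)))"

lemma bump_DERIV: "(bump a b n has_real_derivative bump' a b n t) (at t)"
proof -
  define s where "s = (\<lambda>t. real n * ((t - a) * (b - t)) - 1)"
  have s: "(s has_real_derivative real n * (a + b - 2 * t)) (at t)"
    unfolding s_def by (auto intro!: derivative_eq_intros simp: algebra_simps)
  have "((\<lambda>t. (max 0 (s t))\<^sup>2) has_real_derivative 2 * max 0 (s t) * (real n * (a + b - 2 * t))) (at t)"
    by (rule DERIV_chain2[OF DERIV_positive_part_square s])
  note sq = this
  have pos: "1 + (max 0 (s t))\<^sup>2 \<noteq> 0"
    using zero_le_power2[of "max 0 (s t)"] by linarith
  have "((\<lambda>t. (max 0 (s t))\<^sup>2 / (1 + (max 0 (s t))\<^sup>2)) has_real_derivative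
      2 * max 0 (s t) * (real n * (a + b - 2 * t)) / (1 + (max 0 (s t))\<^sup>2)\<^sup>2) (at t)"
    by (rule DERIV_cong[OF DERIV_divide[OF sq DERIV_add[OF DERIV_const sq] pos]])
      (simp add: algebra_simps power2_eq_square)
  then show ?thesis
    unfolding bump_def[abs_def] bump'_def Let_def s_def by simp
qed

lemma one_plus_square_pos: "0 < 1 + (x::real)\<^sup>2"
  using zero_le_power2[of x] by linarith

lemma continuous_on_bump: "continuous_on A (bump a b n)"
  using bump_DERIV by (meson DERIV_isCont continuous_at_imp_continuous_on)

lemma continuous_on_bump': "continuous_on A (bump' a b n)"
  unfolding bump'_def[abs_def] Let_def
  by (intro continuous_intros) (simp_all add: one_plus_square_pos[THEN less_imp_neq, symmetric])

lemma bump_nonneg: "0 \<le> bump a b n t"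
  by (simp add: bump_def Let_def)

lemma bump_le_1: "bump a b n t \<le> 1"
  by (simp add: bump_def Let_def divide_le_eq one_plus_square_pos)

lemma bump_outside: 
  assumes "real n * ((t - a) * (b - t)) < 1"
  shows "bump a b n t = 0" "bump' a b n t = 0"
  using assms by (simp_all add: bump_def bump'_def Let_def max_def)

text \<open>A positive product has factors of equal sign, and two negative factors would give
  \<open>b < t < a\<close>.\<close>

lemma bump_support:
  assumes "a < b" "1 \<le> real n * ((t - a) * (b - t))"
  shows "a < t" "t < b"
proof -
  have "0 < real n * ((t - a) * (b - t))"
    using assms(2) by linarith
  then have "0 < (t - a) * (b - t)"
    by (simp add: zero_less_mult_iff)
  then show "a < t" "t < b"
    using assms(1) by (auto simp: zero_less_mult_iff)
qed

lemma bump_endpoints: "bump a b n a = 0" "bump a b n b = 0"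
  by (simp_all add: bump_outside)

lemma bump_tendsto:
  assumes "a < t" "t < b"
  shows "(\<lambda>n. bump a b n t) \<longlonglongrightarrow> 1"
proof -
  define q where "q = (t - a) * (b - t)"
  have q: "0 < q"
    using assms by (simp add: q_def)
  have "filterlim (\<lambda>n. real n * q - 1) at_top sequentially"
    using q by real_asymp
  then have "filterlim (\<lambda>n. 1 + (real n * q - 1)\<^sup>2) at_top sequentially"
    using q by real_asymp
  then have "(\<lambda>n. 1 - inverse (1 + (real n * q - 1)\<^sup>2)) \<longlonglongrightarrow> 1 - 0"
    by (intro tendsto_intros tendsto_inverse_0_at_top)
  moreover have "eventually (\<lambda>n. 1 - inverse (1 + (real n * q - 1)\<^sup>2) = bump a b n t) sequentially"
  proof -
    have "eventually (\<lambda>n. 1 \<le> real n * q) sequentially"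
      using q by real_asymp
    then show ?thesis
    proof eventually_elim
      case (elim n)
      then have "bump a b n t = (real n * q - 1)\<^sup>2 / (1 + (real n * q - 1)\<^sup>2)"
        by (simp add: bump_def Let_def q_def)
      also have "\<dots> = 1 - inverse (1 + (real n * q - 1)\<^sup>2)"
        using one_plus_square_pos[of "real n * q - 1"] by (simp add: field_simps)
      finally show ?case
        by simp
    qed
  qed
  ultimately show ?thesis
    using tendsto_cong by fastforce
qed

definition bump2 :: "real \<Rightarrow> real \<Rightarrow> real \<Rightarrow> real \<Rightarrow> nat \<Rightarrow> scalar_field"
  where "bump2 a b c d n x = bump a b n (fst x) * bump c d n (snd x)"

definition bump2_gradient :: "real \<Rightarrow> real \<Rightarrow> real \<Rightarrow> real \<Rightarrow> nat \<Rightarrow> vector_field"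
  where "bump2_gradient a b c d n x =
    (bump' a b n (fst x) * bump c d n (snd x), bump a b n (fst x) * bump' c d n (snd x))"

lemma continuous_on_compose_fst_snd:
  fixes f :: "real \<Rightarrow> real"
  assumes "continuous_on UNIV f"
  shows "continuous_on A (\<lambda>x::point. f (fst x))" "continuous_on A (\<lambda>x::point. f (snd x))"
proof -
  show "continuous_on A (\<lambda>x::point. f (fst x))"
    by (rule continuous_on_compose2[OF assms]) (auto intro: continuous_intros)
  show "continuous_on A (\<lambda>x::point. f (snd x))"
    by (rule continuous_on_compose2[OF assms]) (auto intro: continuous_intros)
qed

lemma continuous_on_bump2: "continuous_on A (bump2 a b c d n)"
  unfolding bump2_def[abs_def]
  by (intro continuous_intros continuous_on_compose_fst_snd continuous_on_bump)

lemma continuous_on_bump2_gradient: "continuous_on A (bump2_gradient a b c d n)"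
  unfolding bump2_gradient_def[abs_def]
  by (intro continuous_intros continuous_on_compose_fst_snd continuous_on_bump continuous_on_bump')

lemma C1_bump2: "C1_with_gradient (bump2 a b c d n) (bump2_gradient a b c d n)"
  unfolding C1_with_gradient_def
proof (intro conjI allI)
  fix x :: point
  have 1: "((\<lambda>x::point. bump a b n (fst x)) has_derivative (\<lambda>v. bump' a b n (fst x) * fst v)) (at x)"
    using bump_DERIV[of a b n "fst x"] unfolding has_field_derivative_def
    by (rule has_derivative_compose[rotated]) (auto intro!: derivative_intros)
  have 2: "((\<lambda>x::point. bump c d n (snd x)) has_derivative (\<lambda>v. bump' c d n (snd x) * snd v)) (at x)"
    using bump_DERIV[of c d n "snd x"] unfolding has_field_derivative_def
    by (rule has_derivative_compose[rotated]) (auto intro!: derivative_intros)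
  show "(bump2 a b c d n has_derivative (\<lambda>v. bump2_gradient a b c d n x \<bullet> v)) (at x)"
    unfolding bump2_def[abs_def] bump2_gradient_def
    by (rule has_derivative_eq_rhs[OF has_derivative_mult[OF 1 2]])
      (auto simp: inner_prod_def fun_eq_iff algebra_simps)
next
  show "continuous_on UNIV (bump2_gradient a b c d n)"
    by (rule continuous_on_bump2_gradient)
qed

text \<open>A point off the open box has a coordinate at which both the one-dimensional cutoff and
  its derivative vanish, and every product involved contains one of these two as a factor.\<close>

lemma bump2_outside:
  assumes "a < b" "c < d" "x \<notin> {a<..<b} \<times> {c<..<d}"
  shows "bump2 a b c d n x = 0" "bump2_gradient a b c d n x = 0"
proof -
  have "real n * ((fst x - a) * (b - fst x)) < 1 \<or> real n * ((snd x - c) * (d - snd x)) < 1"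
    using assms(3) bump_support[OF assms(1), of n "fst x"] bump_support[OF assms(2), of n "snd x"]
    unfolding mem_Times_iff greaterThanLessThan_iff not_le[symmetric] by blast
  then show "bump2 a b c d n x = 0" "bump2_gradient a b c d n x = 0"
    by (auto simp: bump2_def bump2_gradient_def bump_outside zero_prod_def)
qed

lemma compactly_supported_bump2:
  assumes "a < b" "c < d" "{a<..<b} \<times> {c<..<d} \<subseteq> \<Omega>"
  shows "compactly_supported_in \<Omega> (bump2 a b c d n)"
  unfolding compactly_supported_in_def
proof (intro exI conjI allI impI)
  \<comment> \<open>The set where both arguments of the positive part are nonnegative: closed by the
    weak inequalities, yet inside the open box by \<open>bump_support\<close>.\<close>
  let ?K = "{x::point. 1 \<le> real n * ((fst x - a) * (b - fst x))} \<inter> {x. 1 \<le> real n * ((snd x - c) * (d - snd x))}"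
  have sub: "?K \<subseteq> {a<..<b} \<times> {c<..<d}"
    using bump_support[OF assms(1)] bump_support[OF assms(2)] by (auto simp: mem_Times_iff)
  have "closed ?K"
    by (intro closed_Int closed_Collect_le continuous_intros)
  moreover have "bounded ({a<..<b} \<times> {c<..<d})"
    by (intro bounded_Times) auto
  ultimately show "compact ?K"
    using bounded_subset[OF _ sub] by (simp add: compact_eq_bounded_closed)
  show "?K \<subseteq> \<Omega>"
    using sub assms(3) by simp
  show "bump2 a b c d n x = 0" if "x \<notin> ?K" for x
    using that by (auto simp: bump2_def bump_outside not_le)
qed

section \<open>Testing a weak divergence against cutoffs on a box\<close>

lemma integral_cbox_mult:
  fixes f g :: "real \<Rightarrow> real"
  assumes "continuous_on UNIV f" "continuous_on UNIV g"
  shows "integral (cbox (a, c) (b, d)) (\<lambda>x. f (fst x) * g (snd x)) = integral {a..b} f * integral {c..d} g"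
proof -
  have "integral (cbox (a, c) (b, d)) (\<lambda>x. f (fst x) * g (snd x))
      = integral (cbox a b) (\<lambda>x. integral (cbox c d) (\<lambda>y. f x * g y))"
    by (subst integral_prod_continuous)
      (auto intro!: continuous_intros continuous_on_compose_fst_snd assms)
  then show ?thesis
    by simp
qed

text \<open>The integrand is the derivative of the affine function times \<open>bump\<close>, and
  \<open>bump\<close> vanishes at both endpoints.\<close>

lemma integral_derivative_affine_bump:
  assumes "a \<le> b"
  shows "integral {a..b} (\<lambda>t. e1 * bump a b n t + (e0 + e1 * t) * bump' a b n t) = 0"
proof -
  have "((\<lambda>t. e1 * bump a b n t + (e0 + e1 * t) * bump' a b n t) has_integral
      (e0 + e1 * b) * bump a b n b - (e0 + e1 * a) * bump a b n a) {a..b}"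
  proof (rule fundamental_theorem_of_calculus[OF assms])
    fix t
    have "((\<lambda>t. (e0 + e1 * t) * bump a b n t) has_real_derivative
        e1 * bump a b n t + (e0 + e1 * t) * bump' a b n t) (at t within {a..b})"
      by (auto intro!: derivative_eq_intros DERIV_subset[OF bump_DERIV])
    then show "((\<lambda>t. (e0 + e1 * t) * bump a b n t) has_vector_derivative
        e1 * bump a b n t + (e0 + e1 * t) * bump' a b n t) (at t within {a..b})"
      by (simp add: has_real_derivative_iff_has_vector_derivative)
  qed
  then show ?thesis
    by (simp add: bump_endpoints integral_unique)
qed

text \<open>Integration by parts without boundary terms: after moving the right-hand side over, the
  integrand is a sum of two products of one-variable functions, each with a factor of integral
  zero.\<close>

lemma integral_affine_bump2_gradient:
  assumes "a < b" "c < d"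
  shows "integral (cbox (a, c) (b, d)) (\<lambda>x. (a1 + b1 * fst x, a2 + b2 * snd x) \<bullet> bump2_gradient a b c d n x)
    = - (b1 + b2) * integral (cbox (a, c) (b, d)) (bump2 a b c d n)" (is "integral ?A ?f = _ * integral ?A ?\<phi>")
proof -
  define u where "u = (\<lambda>t. b1 * bump a b n t + (a1 + b1 * t) * bump' a b n t)"
  define v where "v = (\<lambda>t. b2 * bump c d n t + (a2 + b2 * t) * bump' c d n t)"
  have cont: "continuous_on UNIV u" "continuous_on UNIV v"
    unfolding u_def v_def by (intro continuous_intros continuous_on_bump continuous_on_bump')+
  have "?f integrable_on ?A" "?\<phi> integrable_on ?A"
    by (intro integrable_continuous continuous_intros continuous_on_bump2 continuous_on_bump2_gradient)+
  then have "integral ?A ?f + (b1 + b2) * integral ?A ?\<phi> = integral ?A (\<lambda>x. ?f x + (b1 + b2) * ?\<phi> x)"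
    by (subst integral_add) (auto intro!: integrable_on_mult_right)
  also have "(\<lambda>x. ?f x + (b1 + b2) * ?\<phi> x)
      = (\<lambda>x. u (fst x) * bump c d n (snd x) + bump a b n (fst x) * v (snd x))"
    by (auto simp: fun_eq_iff u_def v_def bump2_def bump2_gradient_def algebra_simps)
  also have "integral ?A \<dots> = integral ?A (\<lambda>x. u (fst x) * bump c d n (snd x))
      + integral ?A (\<lambda>x. bump a b n (fst x) * v (snd x))"
    by (intro integral_add integrable_continuous continuous_intros continuous_on_compose_fst_snd
        continuous_on_bump cont)
  also have "\<dots> = integral {a..b} u * integral {c..d} (bump c d n)
      + integral {a..b} (bump a b n) * integral {c..d} v"
    by (simp add: integral_cbox_mult cont continuous_on_bump)
  also have "\<dots> = 0"
    using assms unfolding u_def v_def by (simp add: integral_derivative_affine_bump)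
  finally show ?thesis
    by (simp add: algebra_simps)
qed

text \<open>The weak formulation uses Lebesgue integrals over the domain, whereas Fubini and the
  fundamental theorem are applied to \<open>integral\<close> on a closed box. Both functions vanish
  off the open box, so the integrands agree everywhere and no null set intervenes.\<close>

lemma set_lebesgue_integral_restrict_cbox:
  fixes f g :: "point \<Rightarrow> real"
  assumes "a < b" "c < d" "{a<..<b} \<times> {c<..<d} \<subseteq> \<Omega>" "continuous_on UNIV g"
    and "\<And>x. x \<in> {a<..<b} \<times> {c<..<d} \<Longrightarrow> f x = g x"
    and "\<And>x. x \<notin> {a<..<b} \<times> {c<..<d} \<Longrightarrow> f x = 0 \<and> g x = 0"
  shows "(LINT x:\<Omega>|lborel. f x) = integral (cbox (a, c) (b, d)) g"
proof -
  let ?A = "cbox (a, c) (b, d)"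
  have "{a<..<b} \<times> {c<..<d} \<subseteq> ?A"
    by (auto simp: cbox_Pair_eq)
  then have "indicator \<Omega> x *\<^sub>R f x = indicator ?A x *\<^sub>R g x" for x
    using assms(3) assms(5,6)[of x] by (cases "x \<in> {a<..<b} \<times> {c<..<d}") (auto simp: subset_iff)
  then have "(LINT x:\<Omega>|lborel. f x) = (LINT x:?A|lborel. g x)"
    by (simp add: set_lebesgue_integral_def)
  also have "\<dots> = integral ?A g"
  proof (rule set_borel_integral_eq_integral)
    show "set_integrable lborel ?A g"
      unfolding set_integrable_def
      by (intro borel_integrable_compact compact_cbox continuous_on_subset[OF assms(4)]) simp
  qed
  finally show ?thesis .
qed

lemma weak_divergence_test_bump2:
  assumes div: "weak_divergence \<Omega> p d" and ab: "a < b" "c < e"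
    and sub: "{a<..<b} \<times> {c<..<e} \<subseteq> \<Omega>"
    and p: "\<And>x. x \<in> {a<..<b} \<times> {c<..<e} \<Longrightarrow> p x = (a1 + b1 * fst x, a2 + b2 * snd x)"
  shows "(LINT x:\<Omega>|lborel. d x * bump2 a b c e n x) = (b1 + b2) * (LINT x:\<Omega>|lborel. bump2 a b c e n x)"
proof -
  let ?\<phi> = "bump2 a b c e n" and ?G = "bump2_gradient a b c e n"
  have "(LINT x:\<Omega>|lborel. p x \<bullet> ?G x) = integral (cbox (a, c) (b, e)) (\<lambda>x. (a1 + b1 * fst x, a2 + b2 * snd x) \<bullet> ?G x)"
    by (rule set_lebesgue_integral_restrict_cbox[OF ab sub])
      (auto simp: p bump2_outside[OF ab] intro!: continuous_intros continuous_on_bump2_gradient)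
  also have "\<dots> = - (b1 + b2) * integral (cbox (a, c) (b, e)) ?\<phi>"
    by (rule integral_affine_bump2_gradient[OF ab])
  also have "integral (cbox (a, c) (b, e)) ?\<phi> = (LINT x:\<Omega>|lborel. ?\<phi> x)"
    by (rule set_lebesgue_integral_restrict_cbox[OF ab sub, symmetric])
      (auto simp: bump2_outside[OF ab] continuous_on_bump2)
  finally have "(LINT x:\<Omega>|lborel. p x \<bullet> ?G x) = - (b1 + b2) * (LINT x:\<Omega>|lborel. ?\<phi> x)" .
  moreover have "(LINT x:\<Omega>|lborel. p x \<bullet> ?G x) = - (LINT x:\<Omega>|lborel. d x * ?\<phi> x)"
    using div C1_bump2 compactly_supported_bump2[OF ab sub] unfolding weak_divergence_def by blast
  ultimately show ?thesis
    by (simp add: algebra_simps)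
qed

text \<open>Lebesgue differentiation: outside a negligible set, \<open>f x\<close> is the limit of
  averages over shrinking cubes with corner \<open>x\<close>, and all of these averages are
  zero.\<close>

lemma AE_zero_of_box_integrals:
  fixes f :: "'a::euclidean_space \<Rightarrow> real"
  assumes f: "integrable lborel f" and zero: "\<And>u w. (LINT x:box u w|lborel. f x) = 0"
  shows "AE x in lborel. f x = 0"
proof -
  have on_cbox: "f integrable_on cbox u w" for u w
    using integrable_on_lborel[OF f] by (rule integrable_on_subcbox) simp
  have integral_zero: "integral (cbox u w) f = 0" for u w
  proof -
    have "set_integrable lborel (box u w) f"
      unfolding set_integrable_def using f by (intro integrable_mult_indicator) auto
    then show ?thesis
      using set_borel_integral_eq_integral(2) zero integral_open_interval by metis
  qed
  obtain N where N: "negligible N"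
    "\<And>x e. x \<notin> N \<Longrightarrow> 0 < e \<Longrightarrow> \<exists>d>0. \<forall>h. 0 < h \<and> h < d \<longrightarrow>
      norm (integral (cbox x (x + h *\<^sub>R One)) f /\<^sub>R h ^ DIM('a) - f x) < e"
    using integrable_ccontinuous_explicit[OF on_cbox] by metis
  have "f x = 0" if xN: "x \<notin> N" for x
  proof (rule ccontr)
    assume "f x \<noteq> 0"
    then obtain d where d: "0 < d" "\<And>h. 0 < h \<Longrightarrow> h < d \<Longrightarrow>
        norm (integral (cbox x (x + h *\<^sub>R One)) f /\<^sub>R h ^ DIM('a) - f x) < \<bar>f x\<bar>"
      using N(2)[OF xN, of "\<bar>f x\<bar>"] by auto
    show False
      using d(2)[of "d / 2"] d(1) by (simp add: integral_zero)
  qed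
  moreover have "AE x in lebesgue. x \<notin> N"
    using N(1) by (intro AE_not_in) (simp add: negligible_iff_null_sets)
  ultimately have "AE x in lebesgue. f x = 0"
    by auto
  then show ?thesis
    by (simp add: AE_completion_iff)
qed

text \<open>Testing with bump functions and integrating by parts shows that \<open>d - (b1 + b2)\<close> has integral zero
  over every box in the rectangle.\<close>

lemma AE_weak_divergence_affine:
  assumes div: "weak_divergence \<Omega> p d" and \<Omega>: "bounded \<Omega>" "\<Omega> \<in> sets borel"
    and sub: "{a<..<b} \<times> {c<..<e} \<subseteq> \<Omega>"
    and p: "\<And>x. x \<in> {a<..<b} \<times> {c<..<e} \<Longrightarrow> p x = (a1 + b1 * fst x, a2 + b2 * snd x)"
  shows "AE x in lborel. x \<in> {a<..<b} \<times> {c<..<e} \<longrightarrow> d x = b1 + b2"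
proof -
  let ?T = "{a<..<b} \<times> {c<..<e}"
  have T: "?T \<in> sets borel"
    by (simp add: open_Times)
  have d_cont: "set_integrable lborel \<Omega> (\<lambda>x. d x * f x)" if "continuous_on UNIV f" for f
    using square_integrable_inner[of \<Omega> d f] square_integrable_continuous[OF \<Omega> that] div
    by (simp add: weak_divergence_def)
  have cont: "set_integrable lborel \<Omega> f" if "continuous_on UNIV f" for f :: "point \<Rightarrow> real"
    using square_integrable_inner[OF square_integrable_continuous[OF \<Omega> continuous_on_const[of _ 1]]
        square_integrable_continuous[OF \<Omega> that]] by simp
  define D where "D = (\<lambda>x. indicator \<Omega> x *\<^sub>R (d x - (b1 + b2)))"
  have "set_integrable lborel \<Omega> (\<lambda>x. d x * 1 - (b1 + b2))"
    by (intro set_integral_diff(1) d_cont cont continuous_intros)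
  then have D: "integrable lborel D"
    by (simp add: D_def set_integrable_def)
  define f where "f = (\<lambda>x. indicator ?T x * D x)"
  have "integrable lborel f"
    using integrable_mult_indicator[OF _ D, of ?T] T by (simp add: f_def)
  moreover have "(LINT x:box u w|lborel. f x) = 0" for u w
  proof -
    obtain u1 u2 w1 w2 where uw: "u = (u1, u2)" "w = (w1, w2)"
      by (metis surj_pair)
    \<comment> \<open>The intersection of the test box with the rectangle is again a box, possibly
      empty, so it has its own cutoffs.\<close>
    let ?a = "max a u1" and ?b = "min b w1" and ?c = "max c u2" and ?e = "min e w2"
    let ?R = "{?a<..<?b} \<times> {?c<..<?e}"
    have R: "indicator (box u w) x *\<^sub>R f x = D x * indicator ?R x" for x
      by (auto simp: f_def uw mem_box Basis_prod_def indicator_def split: if_splits)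
    have "(LINT x|lborel. D x * indicator ?R x) = 0"
    proof (cases "?a < ?b \<and> ?c < ?e")
      case False
      then have "?R = {}"
        by auto
      show ?thesis
        unfolding \<open>?R = {}\<close> by simp
    next
      case True
      let ?\<phi> = "bump2 ?a ?b ?c ?e"
      have R_sub: "?R \<subseteq> ?T"
        by auto
      have "(LINT x|lborel. D x * ?\<phi> n x) = 0" for n
      proof -
        have "(LINT x:\<Omega>|lborel. d x * ?\<phi> n x) = (b1 + b2) * (LINT x:\<Omega>|lborel. ?\<phi> n x)"
          using True R_sub sub by (intro weak_divergence_test_bump2[OF div]) (auto simp: p subset_iff)
        moreover have "(LINT x:\<Omega>|lborel. d x * ?\<phi> n x - (b1 + b2) * ?\<phi> n x)
            = (LINT x:\<Omega>|lborel. d x * ?\<phi> n x) - (LINT x:\<Omega>|lborel. (b1 + b2) * ?\<phi> n x)"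
          by (intro set_integral_diff(2) d_cont cont continuous_intros continuous_on_bump2)
        moreover have "(LINT x|lborel. D x * ?\<phi> n x) = (LINT x:\<Omega>|lborel. d x * ?\<phi> n x - (b1 + b2) * ?\<phi> n x)"
          by (simp add: set_lebesgue_integral_def D_def algebra_simps)
        ultimately show ?thesis
          by simp
      qed
      \<comment> \<open>The cutoffs are bounded by 1 and tend pointwise to the indicator of the open
        box, so \<open>\<bar>D x\<bar>\<close> dominates and the vanishing integrals pass to the
        limit.\<close>
      moreover have "(\<lambda>n. LINT x|lborel. D x * ?\<phi> n x) \<longlonglongrightarrow> (LINT x|lborel. D x * indicator ?R x)"
      proof (rule integral_dominated_convergence[where w = "\<lambda>x. \<bar>D x\<bar>"])
        have [measurable]: "D \<in> borel_measurable borel"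
          using borel_measurable_integrable[OF D] by simp
        have [measurable]: "?R \<in> sets borel"
          by (simp add: open_Times)
        have [measurable]: "?\<phi> n \<in> borel_measurable borel" for n
          by (rule borel_measurable_continuous_onI) (rule continuous_on_bump2)
        show "(\<lambda>x. D x * indicator ?R x) \<in> borel_measurable lborel"
          by measurable
        show "(\<lambda>x. D x * ?\<phi> n x) \<in> borel_measurable lborel" for n
          by measurable
        show "integrable lborel (\<lambda>x. \<bar>D x\<bar>)"
          using D by simp
        have "(\<lambda>n. ?\<phi> n x) \<longlonglongrightarrow> indicator ?R x" for x
        proof (cases "x \<in> ?R")
          case True
          then have "(\<lambda>n. bump ?a ?b n (fst x) * bump ?c ?e n (snd x)) \<longlonglongrightarrow> 1 * 1"
            by (intro tendsto_mult bump_tendsto) (auto simp: mem_Times_iff)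
          then show ?thesis
            using True by (simp add: bump2_def)
        next
          case False
          then show ?thesis
            using \<open>?a < ?b \<and> ?c < ?e\<close> by (simp add: bump2_outside)
        qed
        then show "AE x in lborel. (\<lambda>n. D x * ?\<phi> n x) \<longlonglongrightarrow> D x * indicator ?R x"
          by (intro AE_I2 tendsto_intros)
        have "\<bar>?\<phi> n x\<bar> \<le> 1" for n x
          using bump_nonneg bump_le_1 by (simp add: bump2_def abs_mult mult_le_one)
        then show "AE x in lborel. norm (D x * ?\<phi> n x) \<le> \<bar>D x\<bar>" for n
          by (intro AE_I2) (simp add: abs_mult mult_left_le)
      qed
      ultimately show ?thesis
        by (simp add: LIMSEQ_const_iff)
    qed
    then show ?thesis
      unfolding set_lebesgue_integral_def R .
  qed
  ultimately have "AE x in lborel. f x = 0"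
    by (rule AE_zero_of_box_integrals)
  then show ?thesis
    by eventually_elim (use sub in \<open>auto simp: f_def D_def\<close>)
qed

section \<open>Linear structure of the fields with square integrable divergence\<close>

lemma C1_with_gradient_continuous: "C1_with_gradient \<phi> G \<Longrightarrow> continuous_on A \<phi>"
  unfolding C1_with_gradient_def
  by (meson has_derivative_continuous continuous_at_imp_continuous_on)

text \<open>Test functions and their gradients are continuous, hence square integrable on a bounded
  set. This integrability permits splitting the integral of a sum in
  \<open>H0_div_add\<close>.\<close>

lemma set_integrable_test:
  assumes "bounded \<Omega>" "\<Omega> \<in> sets borel" "C1_with_gradient \<phi> G"
  shows "square_integrable \<Omega> p \<Longrightarrow> set_integrable lborel \<Omega> (\<lambda>x. p x \<bullet> G x)"
    and "square_integrable \<Omega> d \<Longrightarrow> set_integrable lborel \<Omega> (\<lambda>x. d x * \<phi> x)"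
proof -
  show "set_integrable lborel \<Omega> (\<lambda>x. p x \<bullet> G x)" if "square_integrable \<Omega> p"
    using square_integrable_inner[OF that square_integrable_continuous[OF assms(1,2)]] assms(3)
    by (simp add: C1_with_gradient_def)
  show "set_integrable lborel \<Omega> (\<lambda>x. d x * \<phi> x)" if "square_integrable \<Omega> d"
    using square_integrable_inner[OF that square_integrable_continuous[OF assms(1,2)]]
      C1_with_gradient_continuous[OF assms(3)] by simp
qed

lemma H0_div_scaleR:
  assumes "p \<in> H0_div \<Omega>"
  shows "c *\<^sub>R p \<in> H0_div \<Omega>"
proof -
  obtain d where p: "square_integrable \<Omega> p" and d: "weak_divergence \<Omega> p d" "zero_normal_trace \<Omega> p d"
    using assms by (auto simp: H0_div_def)
  have "weak_divergence \<Omega> (c *\<^sub>R p) (c *\<^sub>R d)"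
    using d(1) unfolding weak_divergence_def
    by (auto simp: square_integrable_scaleR mult.assoc)
  moreover have "zero_normal_trace \<Omega> (c *\<^sub>R p) (c *\<^sub>R d)"
    using d(2) unfolding zero_normal_trace_def
    by (auto simp: mult.assoc simp flip: distrib_left)
  ultimately show ?thesis
    using square_integrable_scaleR[OF p] by (auto simp: H0_div_def)
qed

lemma H0_div_add:
  assumes \<Omega>: "bounded \<Omega>" "\<Omega> \<in> sets borel" and "p \<in> H0_div \<Omega>" "q \<in> H0_div \<Omega>"
  shows "p + q \<in> H0_div \<Omega>"
proof -
  obtain d where p: "square_integrable \<Omega> p" and d: "weak_divergence \<Omega> p d" "zero_normal_trace \<Omega> p d"
    using assms by (auto simp: H0_div_def)
  obtain e where q: "square_integrable \<Omega> q" and e: "weak_divergence \<Omega> q e" "zero_normal_trace \<Omega> q e"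
    using assms by (auto simp: H0_div_def)
  have de: "square_integrable \<Omega> d" "square_integrable \<Omega> e"
    using d e by (auto simp: weak_divergence_def)
  note test = set_integrable_test[OF \<Omega>]
  have "weak_divergence \<Omega> (p + q) (d + e)"
    unfolding weak_divergence_def
  proof (intro conjI allI impI)
    show "square_integrable \<Omega> (d + e)"
      using de by (rule square_integrable_add)
    fix \<phi> G
    assume \<phi>: "C1_with_gradient \<phi> G" "compactly_supported_in \<Omega> \<phi>"
    have "(LINT x:\<Omega>|lborel. (p + q) x \<bullet> G x) = (LINT x:\<Omega>|lborel. p x \<bullet> G x) + (LINT x:\<Omega>|lborel. q x \<bullet> G x)"
      using set_integral_add(2)[OF test(1)[OF \<phi>(1) p] test(1)[OF \<phi>(1) q]]
      by (simp add: inner_add_left)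
    also have "\<dots> = - ((LINT x:\<Omega>|lborel. d x * \<phi> x) + (LINT x:\<Omega>|lborel. e x * \<phi> x))"
      using d(1) e(1) \<phi> by (simp add: weak_divergence_def)
    also have "\<dots> = - (LINT x:\<Omega>|lborel. (d + e) x * \<phi> x)"
      using set_integral_add(2)[OF test(2)[OF \<phi>(1) de(1)] test(2)[OF \<phi>(1) de(2)]]
      by (simp add: distrib_right)
    finally show "(LINT x:\<Omega>|lborel. (p + q) x \<bullet> G x) = - (LINT x:\<Omega>|lborel. (d + e) x * \<phi> x)" .
  qed
  moreover have "zero_normal_trace \<Omega> (p + q) (d + e)"
    unfolding zero_normal_trace_def
  proof (intro allI impI)
    fix \<phi> G
    assume \<phi>: "C1_with_gradient \<phi> G"
    have "(LINT x:\<Omega>|lborel. (p x \<bullet> G x + d x * \<phi> x) + (q x \<bullet> G x + e x * \<phi> x))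
        = (LINT x:\<Omega>|lborel. p x \<bullet> G x + d x * \<phi> x) + (LINT x:\<Omega>|lborel. q x \<bullet> G x + e x * \<phi> x)"
      using p q de by (intro set_integral_add test[OF \<phi>])
    also have "\<dots> = 0"
      using d(2) e(2) \<phi> by (simp add: zero_normal_trace_def)
    finally show "(LINT x:\<Omega>|lborel. (p + q) x \<bullet> G x + (d + e) x * \<phi> x) = 0"
      by (simp add: inner_add_left distrib_right algebra_simps)
  qed
  ultimately show ?thesis
    using square_integrable_add[OF p q] by (auto simp: H0_div_def)
qed

lemma H0_div_zero: "0 \<in> H0_div \<Omega>"
  unfolding H0_div_def weak_divergence_def zero_normal_trace_def
  by (auto simp: square_integrable_zero intro!: exI[of _ 0])

text \<open>Keeps the coefficients that \<open>RT0\<close> hides under quantifiers, so that they can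
  be followed through sums and multiples; \<open>b1 + b2\<close> is the divergence.\<close>

definition affine_on :: "point set \<Rightarrow> vector_field \<Rightarrow> real \<Rightarrow> real \<Rightarrow> real \<Rightarrow> real \<Rightarrow> bool"
  where "affine_on T p a1 b1 a2 b2 \<longleftrightarrow> (\<forall>x\<in>T. p x = (a1 + b1 * fst x, a2 + b2 * snd x))"

lemma affine_on_add:
  "\<lbrakk>affine_on T p a1 b1 a2 b2; affine_on T q c1 d1 c2 d2\<rbrakk>
    \<Longrightarrow> affine_on T (p + q) (a1 + c1) (b1 + d1) (a2 + c2) (b2 + d2)"
  by (simp add: affine_on_def algebra_simps)

lemma affine_on_scaleR:
  "affine_on T p a1 b1 a2 b2 \<Longrightarrow> affine_on T (c *\<^sub>R p) (c * a1) (c * b1) (c * a2) (c * b2)"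
  by (simp add: affine_on_def algebra_simps)

section \<open>The discrete divergence operator\<close>

context grid
begin

lemma Y_affine_on:
  assumes "p \<in> Y" "T \<in> elems"
  obtains a1 b1 a2 b2 where "affine_on T p a1 b1 a2 b2"
  using assms unfolding Y_h_def RT0_def affine_on_def by blast

lemma subspace_Y: "subspace Y"
  unfolding subspace_def
proof (intro conjI ballI allI)
  show "0 \<in> Y"
    unfolding Y_h_def RT0_def
    by (auto simp: H0_div_zero normalized_def zero_prod_def intro!: exI[of _ 0])
next
  fix p q
  assume pq: "p \<in> Y" "q \<in> Y"
  have "RT0 T (p + q)" if "T \<in> elems" for T
    using Y_affine_on[OF pq(1) that] Y_affine_on[OF pq(2) that] affine_on_add
    unfolding RT0_def affine_on_def[symmetric] by metis
  then show "p + q \<in> Y"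
    using pq H0_div_add[OF bounded_domain borel_domain] by (auto simp: Y_h_def normalized_def)
next
  fix c p
  assume p: "p \<in> Y"
  have "RT0 T (c *\<^sub>R p)" if "T \<in> elems" for T
    using Y_affine_on[OF p that] affine_on_scaleR
    unfolding RT0_def affine_on_def[symmetric] by metis
  then show "c *\<^sub>R p \<in> Y"
    using p H0_div_scaleR by (auto simp: Y_h_def normalized_def)
qed

text \<open>The part of the domain missed by the open elements lies on finitely many grid lines,
  which are negligible.\<close>

lemma AE_in_elements: "AE x in lborel. x \<in> \<Omega> \<longrightarrow> x \<in> \<Union>elems"
proof -
  define N where "N = (\<Union>i\<in>{..m1}. {x::point. x \<bullet> (1, 0) = real i * h}) \<union> (\<Union>j\<in>{..m2}. {x::point. x \<bullet> (0, 1) = real j * h})"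
  have "negligible N"
    unfolding N_def
    by (intro negligible_Un negligible_Union)
      (auto simp: Basis_prod_def intro!: negligible_standard_hyperplane)
  then have "AE x in lebesgue. x \<notin> N"
    by (intro AE_not_in) (simp add: negligible_iff_null_sets)
  then have AE: "AE x in lborel. x \<notin> N"
    by (simp add: AE_completion_iff)
  have sub: "x \<in> \<Union>elems" if x: "x \<in> \<Omega>" "x \<notin> N" for x
  proof -
    have pos: "0 < fst x" "fst x < real m1 * h" "0 < snd x" "snd x < real m2 * h"
      using x by (auto simp: domain_def)
    have slab: "\<exists>i<m. real i * h < t \<and> t < real (Suc i) * h"
      if t: "0 < t" "t < real m * h" and ne: "\<And>i. i \<le> m \<Longrightarrow> t \<noteq> real i * h" for t and m :: nat
    proof -
      define i where "i = nat \<lfloor>t / h\<rfloor>"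
      have "real i = of_int \<lfloor>t / h\<rfloor>"
        using t h_pos by (simp add: i_def)
      then have i: "real i \<le> t / h" "t / h < real i + 1"
        by linarith+
      have "real i < real m"
        using i(1) t h_pos by (simp add: pos_divide_less_eq[symmetric])
      then have im: "i < m"
        by simp
      have "real i * h \<le> t" "t < real (Suc i) * h"
        using i h_pos by (simp_all add: pos_le_divide_eq pos_divide_less_eq algebra_simps)
      then show ?thesis
        using im ne[of i] by (intro exI[of _ i]) auto
    qed
    obtain i where i: "i < m1" "real i * h < fst x" "fst x < real (Suc i) * h"
      using slab[OF pos(1,2)] x(2) by (auto simp: N_def inner_prod_def)
    obtain j where j: "j < m2" "real j * h < snd x" "snd x < real (Suc j) * h"
      using slab[OF pos(3,4)] x(2) by (auto simp: N_def inner_prod_def)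
    have "x \<in> cell h i j"
      using i j by (simp add: cell_def mem_Times_iff)
    then show ?thesis
      using i j by (auto simp: elements_def)
  qed
  show ?thesis
    using AE by eventually_elim (use sub in blast)
qed

lemma AE_weak_divergence_element:
  assumes "weak_divergence \<Omega> p d" "T \<in> elems" "affine_on T p a1 b1 a2 b2"
  shows "AE x in lborel. x \<in> T \<longrightarrow> d x = b1 + b2"
proof -
  obtain i j where T: "T = cell h i j"
    using assms(2) by (auto simp: elements_def)
  show ?thesis
    unfolding T cell_def
    by (rule AE_weak_divergence_affine[OF assms(1) bounded_domain borel_domain])
      (use assms(3) element_subset_domain[OF assms(2)] in \<open>auto simp: affine_on_def T cell_def\<close>)
qed

text \<open>Two constants that agree almost everywhere on a nonempty open set are equal, since such
  a set is not negligible.\<close>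

lemma value_on_weak_divergence:
  assumes "u \<in> X" "weak_divergence \<Omega> p u" "T \<in> elems" "affine_on T p a1 b1 a2 b2"
  shows "value_on u T = b1 + b2"
proof (rule ccontr)
  assume ne: "value_on u T \<noteq> b1 + b2"
  have "AE x in lborel. x \<in> T \<longrightarrow> u x = b1 + b2"
    using AE_weak_divergence_element assms by blast
  then have "AE x in lborel. x \<notin> T"
    by eventually_elim (use ne value_on_eq[OF assms(1,3)] in auto)
  moreover have "T \<in> sets lborel"
    using elements_properties[OF assms(3)] by simp
  ultimately have "T \<in> null_sets lborel"
    by (simp add: AE_iff_null_sets)
  then have "negligible T"
    by (simp add: negligible_iff_null_sets null_sets_completionI)
  then show False
    using elements_properties[OF assms(3)] open_not_negligible by blast
qed

text \<open>The divergence supplied by \<open>H0_div\<close> is almost everywhere constant on each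
  element. Replacing it by its normalized piecewise constant representative changes none of the test
  integrals.\<close>

lemma weak_divergence_exists:
  assumes "p \<in> Y"
  shows "\<exists>u\<in>X. weak_divergence \<Omega> p u"
proof -
  obtain d where d: "weak_divergence \<Omega> p d"
    using assms by (auto simp: Y_h_def H0_div_def)
  have "\<exists>\<beta>. AE x in lborel. x \<in> T \<longrightarrow> d x = \<beta>" if T: "T \<in> elems" for T
  proof -
    obtain a1 b1 a2 b2 where "affine_on T p a1 b1 a2 b2"
      using Y_affine_on[OF assms T] .
    then show ?thesis
      using AE_weak_divergence_element[OF d T] by blast
  qed
  then obtain \<beta> where \<beta>: "\<And>T. T \<in> elems \<Longrightarrow> AE x in lborel. x \<in> T \<longrightarrow> d x = \<beta> T"
    by metis
  define u where "u = piecewise \<beta>"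
  have u: "u \<in> X"
    by (simp add: u_def piecewise_mem)
  have "AE x in lborel. \<forall>T\<in>elems. x \<in> T \<longrightarrow> d x = \<beta> T"
    using finite_elements \<beta> by (intro AE_finite_allI)
  with AE_in_elements have eq: "AE x in lborel. x \<in> \<Omega> \<longrightarrow> d x = u x"
  proof eventually_elim
    case (elim x)
    show ?case
    proof
      assume "x \<in> \<Omega>"
      then obtain T where T: "T \<in> elems" "x \<in> T"
        using elim(1) by blast
      then show "d x = u x"
        using elim(2) by (simp add: u_def piecewise_eq[OF T])
    qed
  qed
  have sq: "square_integrable \<Omega> u" "square_integrable \<Omega> d"
    using u d by (auto simp: X_h_def weak_divergence_def)
  have "(LINT x:\<Omega>|lborel. d x * \<phi> x) = (LINT x:\<Omega>|lborel. u x * \<phi> x)" if "C1_with_gradient \<phi> G" for \<phi> G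
    unfolding set_lebesgue_integral_def
  proof (rule integral_cong_AE)
    show "(\<lambda>x. indicator \<Omega> x *\<^sub>R (d x * \<phi> x)) \<in> borel_measurable lborel"
      "(\<lambda>x. indicator \<Omega> x *\<^sub>R (u x * \<phi> x)) \<in> borel_measurable lborel"
      using set_integrable_test(2)[OF bounded_domain borel_domain that] sq
      unfolding set_integrable_def by (auto dest: borel_measurable_integrable)
    show "AE x in lborel. indicator \<Omega> x *\<^sub>R (d x * \<phi> x) = indicator \<Omega> x *\<^sub>R (u x * \<phi> x)"
      using eq by eventually_elim (auto simp: indicator_def)
  qed
  then have "weak_divergence \<Omega> p u"
    using d sq unfolding weak_divergence_def by metis
  then show ?thesis
    using u by blast
qed

text \<open>The definite description in \<open>div_h\<close> is proper:
  \<open>weak_divergence_exists\<close> gives a candidate, and the slopes of the field determine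
  every element value of any candidate.\<close>

lemma div_h_properties:
  assumes "p \<in> Y"
  shows "div_h m1 m2 h p \<in> X" and "weak_divergence \<Omega> p (div_h m1 m2 h p)"
proof -
  obtain u where u: "u \<in> X \<and> weak_divergence \<Omega> p u"
    using weak_divergence_exists[OF assms] by blast
  have "div_h m1 m2 h p \<in> X \<and> weak_divergence \<Omega> p (div_h m1 m2 h p)"
    unfolding div_h_def
  proof (rule theI[of _ u])
    show "u \<in> X \<and> weak_divergence \<Omega> p u"
      by (rule u)
    fix v
    assume v: "v \<in> X \<and> weak_divergence \<Omega> p v"
    show "v = u"
    proof (rule X_eqI)
      fix T
      assume T: "T \<in> elems"
      then show "value_on v T = value_on u T"
        using Y_affine_on[OF assms T] value_on_weak_divergence u v by metis
    qed (use u v in auto)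
  qed
  then show "div_h m1 m2 h p \<in> X" "weak_divergence \<Omega> p (div_h m1 m2 h p)"
    by auto
qed

lemma value_on_div_h:
  assumes "p \<in> Y" "T \<in> elems" "affine_on T p a1 b1 a2 b2"
  shows "value_on (div_h m1 m2 h p) T = b1 + b2"
  using value_on_weak_divergence div_h_properties assms by blast

lemma div_h_add:
  assumes "p \<in> Y" "q \<in> Y"
  shows "div_h m1 m2 h (p + q) = div_h m1 m2 h p + div_h m1 m2 h q"
proof (rule X_eqI)
  have pq: "p + q \<in> Y"
    using assms subspace_Y by (simp add: subspace_add)
  then show "div_h m1 m2 h (p + q) \<in> X" "div_h m1 m2 h p + div_h m1 m2 h q \<in> X"
    using assms by (auto intro: div_h_properties X.mem_add)
  fix T
  assume T: "T \<in> elems"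
  obtain a1 b1 a2 b2 where p: "affine_on T p a1 b1 a2 b2"
    using Y_affine_on assms T by blast
  obtain c1 d1 c2 d2 where q: "affine_on T q c1 d1 c2 d2"
    using Y_affine_on assms T by blast
  show "value_on (div_h m1 m2 h (p + q)) T = value_on (div_h m1 m2 h p + div_h m1 m2 h q) T"
    using value_on_div_h[OF pq T affine_on_add[OF p q]] value_on_div_h[OF _ T p] value_on_div_h[OF _ T q]
      assms T div_h_properties by (simp add: value_on_add)
qed

lemma div_h_scaleR:
  assumes "p \<in> Y"
  shows "div_h m1 m2 h (c *\<^sub>R p) = c *\<^sub>R div_h m1 m2 h p"
proof (rule X_eqI)
  have cp: "c *\<^sub>R p \<in> Y"
    using assms subspace_Y by (simp add: subspace_scale)
  then show "div_h m1 m2 h (c *\<^sub>R p) \<in> X" "c *\<^sub>R div_h m1 m2 h p \<in> X"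
    using assms by (auto intro: div_h_properties X.mem_scaleR)
  fix T
  assume T: "T \<in> elems"
  obtain a1 b1 a2 b2 where p: "affine_on T p a1 b1 a2 b2"
    using Y_affine_on assms T by blast
  show "value_on (div_h m1 m2 h (c *\<^sub>R p)) T = value_on (c *\<^sub>R div_h m1 m2 h p) T"
    using value_on_div_h[OF cp T affine_on_scaleR[OF p]] value_on_div_h[OF _ T p]
      assms T div_h_properties by (simp add: value_on_scaleR distrib_left)
qed

end

section \<open>The additive Schwarz iteration\<close>

context complete_inner_subspace
begin

text \<open>The new point is a convex combination of \<open>v\<close>, with weight
  \<open>1 - real (card K) * \<tau>\<close>, and the points \<open>v + d k\<close>, with weight
  \<open>\<tau>\<close> each, so convexity reduces its energy to local ones. Each of these is
  compared, by \<open>opt\<close>, with the damped piece \<open>t *\<^sub>R s k\<close>, and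
  smoothness at \<open>v\<close> bounds the latter.\<close>

lemma parallel_step_bound:
  assumes below: "\<And>v. v \<in> X \<Longrightarrow> \<exists>g\<in>X. \<forall>w\<in>X. E v + ip g (w - v) \<le> E w \<and>
      E w \<le> E v + ip g (w - v) + 1 / (2 * \<alpha>) * (nrm (w - v))\<^sup>2"
    and K: "finite K" "0 \<le> \<tau>" "real (card K) * \<tau> \<le> 1" and t: "0 \<le> t"
    and mem: "v \<in> X" "v' \<in> X" "\<And>k. k \<in> K \<Longrightarrow> d k \<in> X" "\<And>k. k \<in> K \<Longrightarrow> s k \<in> X"
    and decomp: "v' - v = (\<Sum>k\<in>K. s k)"
    and opt: "\<And>k. k \<in> K \<Longrightarrow> E (v + d k) \<le> E (v + t *\<^sub>R s k)"
  shows "E (v + \<tau> *\<^sub>R (\<Sum>k\<in>K. d k))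
    \<le> E v + \<tau> * (t * (E v' - E v) + t\<^sup>2 / (2 * \<alpha>) * (\<Sum>k\<in>K. (nrm (s k))\<^sup>2))"
proof -
  define D where "D = (\<Sum>k\<in>K. d k)"
  have D: "D \<in> X"
    unfolding D_def using subspace mem(3) by (rule subspace_sum)
  define y where "y = v + \<tau> *\<^sub>R D"
  have y: "y \<in> X"
    using mem D by (simp add: y_def mem_add mem_scaleR)
  \<comment> \<open>A supporting functional at the new point yields Jensen's inequality: tested at
    \<open>v\<close> and at every \<open>v + d k\<close>, its linear parts cancel in the weighted
    sum.\<close>
  obtain g where g: "g \<in> X" "\<And>w. w \<in> X \<Longrightarrow> E y + ip g (w - y) \<le> E w"
    using below[OF y] by blast
  have v_y: "ip g (v - y) = - \<tau> * ip g D"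
  proof -
    have "v - y = (- \<tau>) *\<^sub>R D"
      by (simp add: y_def)
    then show ?thesis
      using ip_scaleR_right[OF D g(1), of "- \<tau>"] by simp
  qed
  have "E y + ip g (d k) - \<tau> * ip g D \<le> E (v + d k)" if k: "k \<in> K" for k
  proof -
    have "v + d k - y = d k + (v - y)"
      by simp
    then have "ip g (v + d k - y) = ip g (d k) + ip g (v - y)"
      using ip_add_right[OF mem(3)[OF k] mem_diff[OF mem(1) y] g(1)] by (simp only:)
    then show ?thesis
      using g(2)[of "v + d k"] mem k v_y by (simp add: mem_add)
  qed
  then have "(\<Sum>k\<in>K. E y + ip g (d k) - \<tau> * ip g D) \<le> (\<Sum>k\<in>K. E (v + d k))"
    by (rule sum_mono)
  moreover have "(\<Sum>k\<in>K. ip g (d k)) = ip g D"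
    unfolding D_def using K(1) mem(3) g(1) by (rule ip_sum_right[symmetric])
  ultimately have sum_y: "real (card K) * (E y - \<tau> * ip g D) + ip g D \<le> (\<Sum>k\<in>K. E (v + d k))"
    by (simp add: sum.distrib sum_subtractf algebra_simps)
  have "E y - \<tau> * ip g D \<le> E v"
    using g(2)[OF mem(1)] v_y by simp
  then have "(1 - real (card K) * \<tau>) * (E y - \<tau> * ip g D) \<le> (1 - real (card K) * \<tau>) * E v"
    using K by (intro mult_left_mono) auto
  moreover have "\<tau> * (real (card K) * (E y - \<tau> * ip g D) + ip g D) \<le> \<tau> * (\<Sum>k\<in>K. E (v + d k))"
    using sum_y K by (intro mult_left_mono) auto
  ultimately have step: "E y \<le> E v + \<tau> * ((\<Sum>k\<in>K. E (v + d k)) - real (card K) * E v)"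
    by (simp add: algebra_simps)
  \<comment> \<open>One functional serves two purposes: its quadratic upper bound controls each
    piece, and its lower bound at \<open>v'\<close> controls the sum of the linear terms.\<close>
  obtain f where f: "f \<in> X" "\<And>w. w \<in> X \<Longrightarrow> E v + ip f (w - v) \<le> E w"
    "\<And>w. w \<in> X \<Longrightarrow> E w \<le> E v + ip f (w - v) + 1 / (2 * \<alpha>) * (nrm (w - v))\<^sup>2"
    using below[OF mem(1)] by blast
  have "E (v + d k) \<le> E v + t * ip f (s k) + t\<^sup>2 / (2 * \<alpha>) * (nrm (s k))\<^sup>2" if k: "k \<in> K" for k
    using opt[OF k] f(3)[of "v + t *\<^sub>R s k"] mem k f(1)
    by (simp add: mem_add mem_scaleR ip_lin nrm_scaleR power_mult_distrib)
  then have "(\<Sum>k\<in>K. E (v + d k)) \<le> (\<Sum>k\<in>K. E v + t * ip f (s k) + t\<^sup>2 / (2 * \<alpha>) * (nrm (s k))\<^sup>2)"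
    by (rule sum_mono)
  also have "\<dots> = real (card K) * E v + t * (\<Sum>k\<in>K. ip f (s k)) + t\<^sup>2 / (2 * \<alpha>) * (\<Sum>k\<in>K. (nrm (s k))\<^sup>2)"
    by (simp only: sum.distrib sum_distrib_left) simp
  also have "(\<Sum>k\<in>K. ip f (s k)) = ip f (v' - v)"
    unfolding decomp using K(1) mem(4) f(1) by (rule ip_sum_right[symmetric])
  also have "t * ip f (v' - v) \<le> t * (E v' - E v)"
    using f(2)[OF mem(2)] t by (intro mult_left_mono) auto
  finally have "(\<Sum>k\<in>K. E (v + d k)) - real (card K) * E v
      \<le> t * (E v' - E v) + t\<^sup>2 / (2 * \<alpha>) * (\<Sum>k\<in>K. (nrm (s k))\<^sup>2)"
    by simp
  then have "\<tau> * ((\<Sum>k\<in>K. E (v + d k)) - real (card K) * E v)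
      \<le> \<tau> * (t * (E v' - E v) + t\<^sup>2 / (2 * \<alpha>) * (\<Sum>k\<in>K. (nrm (s k))\<^sup>2))"
    using K(2) by (rule mult_left_mono)
  then show ?thesis
    using step unfolding y_def D_def by simp
qed

text \<open>Minimality is assumed only along the segment towards \<open>w\<close>, as befits a
  constrained minimizer. The upper bound gives
  \<open>0 \<le> t * ip g (w - v) + t\<^sup>2 * a\<close>; dividing by \<open>t\<close> and letting
  it tend to 0 shows that the linear term is nonnegative, so the lower bound retains the quadratic
  term.\<close>

lemma minimum_quadratic_growth:
  assumes g: "g \<in> X" and below: "\<And>w. w \<in> X \<Longrightarrow> E v + ip g (w - v) + 1 / (2 * \<beta>) * (nrm (w - v))\<^sup>2 \<le> E w"
    and above: "\<And>w. w \<in> X \<Longrightarrow> E w \<le> E v + ip g (w - v) + 1 / (2 * \<alpha>) * (nrm (w - v))\<^sup>2"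
    and v: "v \<in> X" "w \<in> X"
    and min: "\<And>t. 0 < t \<Longrightarrow> t \<le> 1 \<Longrightarrow> E v \<le> E (v + t *\<^sub>R (w - v))"
  shows "1 / (2 * \<beta>) * (nrm (w - v))\<^sup>2 \<le> E w - E v"
proof -
  define a where "a = 1 / (2 * \<alpha>) * (nrm (w - v))\<^sup>2"
  define d where "d = w - v"
  have d: "d \<in> X"
    using v by (simp add: d_def mem_diff)
  have "- (t * a) \<le> ip g (w - v)" if t: "0 < t" "t \<le> 1" for t
  proof -
    have "0 \<le> t * ip g (w - v) + t\<^sup>2 * a"
      using min[OF t] above[of "v + t *\<^sub>R d"] v g d unfolding d_def[symmetric] a_def
      by (simp add: mem_add mem_scaleR ip_scaleR_right nrm_scaleR power_mult_distrib)
    also have "\<dots> = t * (ip g (w - v) + t * a)"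
      by (simp add: power2_eq_square algebra_simps)
    finally show ?thesis
      using t by (simp add: zero_le_mult_iff)
  qed
  then have "eventually (\<lambda>t. - (t * a) \<le> ip g (w - v)) (at_right 0)"
    by (intro eventually_at_rightI[of 0 1]) auto
  moreover have "((\<lambda>t. - (t * a)) \<longlongrightarrow> - (0 * a)) (at_right 0)"
    by (intro tendsto_intros)
  ultimately have "- (0 * a) \<le> ip g (w - v)"
    by (intro tendsto_upperbound[of "\<lambda>t. - (t * a)"]) auto
  then show ?thesis
    using below[OF v(2)] by simp
qed

end

section \<open>Edge means and the constraint set\<close>

context grid
begin

lemma cell_mem: "\<lbrakk>i < m1; j < m2\<rbrakk> \<Longrightarrow> cell h i j \<in> elems"
  unfolding elements_def by blast

lemma edge_cell_mem: "e \<in> interior_edges m1 m2 \<Longrightarrow> edge_cell h e \<in> elems"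
  by (cases e) (auto simp: interior_edges_def intro: cell_mem)

text \<open>Covers the closed cell, edges and corners included, so that the one-sided limit in
  \<open>normal_trace\<close> is taken along a nontrivial filter and is unique.\<close>

lemma islimpt_cell:
  assumes "real i * h \<le> fst x" "fst x \<le> real (Suc i) * h" "real j * h \<le> snd x" "snd x \<le> real (Suc j) * h"
  shows "x islimpt cell h i j"
proof (cases "x \<in> cell h i j")
  case True
  then show ?thesis
    using open_cell by (simp add: interior_limit_point interior_open)
next
  case False
  have "real k * h < real (Suc k) * h" for k
    using h_pos by simp
  then have "x \<in> closure (cell h i j)"
    using assms by (simp add: cell_def closure_Times mem_Times_iff)
  then show ?thesis
    using False by (simp add: closure_def)
qed

lemma normal_trace_affine:
  assumes "affine_on S p a1 b1 a2 b2" "S = edge_cell h e" "x islimpt S"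
  shows "normal_trace h p e x = (a1 + b1 * fst x, a2 + b2 * snd x) \<bullet> edge_normal e"
  unfolding normal_trace_def assms(2)[symmetric]
proof (rule tendsto_Lim)
  show "\<not> trivial_limit (at x within S)"
    using assms(3) by (simp add: trivial_limit_within)
  have "((\<lambda>y. (a1 + b1 * fst y, a2 + b2 * snd y) \<bullet> edge_normal e)
      \<longlongrightarrow> (a1 + b1 * fst x, a2 + b2 * snd x) \<bullet> edge_normal e) (at x within S)"
    by (intro tendsto_intros)
  then show "((\<lambda>y. p y \<bullet> edge_normal e) \<longlongrightarrow> (a1 + b1 * fst x, a2 + b2 * snd x) \<bullet> edge_normal e) (at x within S)"
    by (rule Lim_transform_within[of _ _ _ _ 1]) (use assms(1) in \<open>auto simp: affine_on_def\<close>)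
qed

text \<open>The constant normal component on an edge: the first component of the field depends on
  the first coordinate only, which is fixed on a vertical edge, and likewise for horizontal
  ones.\<close>

fun edge_value :: "edge \<Rightarrow> real \<Rightarrow> real \<Rightarrow> real \<Rightarrow> real \<Rightarrow> real"
  where "edge_value (VEdge i j) a1 b1 a2 b2 = a1 + b1 * (real (Suc i) * h)"
  | "edge_value (HEdge i j) a1 b1 a2 b2 = a2 + b2 * (real (Suc j) * h)"

lemma edge_mean_affine:
  assumes "affine_on (edge_cell h e) p a1 b1 a2 b2"
  shows "edge_mean h p e = edge_value e a1 b1 a2 b2"
proof -
  have "normal_trace h p e (edge_start h e + s *\<^sub>R edge_tangent e) = edge_value e a1 b1 a2 b2"
    if s: "s \<in> {0..h}" for s
  proof -
    have lim: "(edge_start h e + s *\<^sub>R edge_tangent e) islimpt edge_cell h e"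
      using s h_pos by (cases e) (auto intro!: islimpt_cell simp: algebra_simps)
    show ?thesis
      unfolding normal_trace_affine[OF assms refl lim] by (cases e) auto
  qed
  then have "integral {0..h} (\<lambda>s. normal_trace h p e (edge_start h e + s *\<^sub>R edge_tangent e))
      = integral {0..h} (\<lambda>s. edge_value e a1 b1 a2 b2)"
    by (rule integral_cong)
  then show ?thesis
    using h_pos by (simp add: edge_mean_def)
qed

lemma edge_mean_add:
  assumes "p \<in> Y" "q \<in> Y" "e \<in> interior_edges m1 m2"
  shows "edge_mean h (p + q) e = edge_mean h p e + edge_mean h q e"
proof -
  have e: "edge_cell h e \<in> elems"
    using assms edge_cell_mem by blast
  obtain a1 b1 a2 b2 where p: "affine_on (edge_cell h e) p a1 b1 a2 b2"
    using Y_affine_on assms e by blast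
  obtain c1 d1 c2 d2 where q: "affine_on (edge_cell h e) q c1 d1 c2 d2"
    using Y_affine_on assms e by blast
  show ?thesis
    unfolding edge_mean_affine[OF affine_on_add[OF p q]] edge_mean_affine[OF p] edge_mean_affine[OF q]
    by (cases e) (auto simp: algebra_simps)
qed

lemma edge_mean_scaleR:
  assumes "p \<in> Y" "e \<in> interior_edges m1 m2"
  shows "edge_mean h (c *\<^sub>R p) e = c * edge_mean h p e"
proof -
  have e: "edge_cell h e \<in> elems"
    using assms edge_cell_mem by blast
  obtain a1 b1 a2 b2 where p: "affine_on (edge_cell h e) p a1 b1 a2 b2"
    using Y_affine_on assms e by blast
  show ?thesis
    unfolding edge_mean_affine[OF affine_on_scaleR[OF p]] edge_mean_affine[OF p]
    by (cases e) (auto simp: algebra_simps)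
qed

lemma convex_C: "convex C"
  unfolding convex_alt
proof (intro ballI allI impI)
  fix p q and t :: real
  assume p: "p \<in> C" and q: "q \<in> C" and t: "0 \<le> t \<and> t \<le> 1"
  have Y: "p \<in> Y" "q \<in> Y" "(1 - t) *\<^sub>R p \<in> Y" "t *\<^sub>R q \<in> Y"
    using p q subspace_Y by (auto simp: C_h_def subspace_scale)
  have "\<bar>edge_mean h ((1 - t) *\<^sub>R p + t *\<^sub>R q) e\<bar> \<le> 1" if e: "e \<in> interior_edges m1 m2" for e
  proof -
    have "\<bar>edge_mean h ((1 - t) *\<^sub>R p + t *\<^sub>R q) e\<bar> = \<bar>(1 - t) * edge_mean h p e + t * edge_mean h q e\<bar>"
      using Y e by (simp add: edge_mean_add edge_mean_scaleR)
    also have "\<dots> \<le> (1 - t) * \<bar>edge_mean h p e\<bar> + t * \<bar>edge_mean h q e\<bar>"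
      using t by (intro order_trans[OF abs_triangle_ineq]) (simp add: abs_mult)
    also have "\<dots> \<le> (1 - t) * 1 + t * 1"
      using p q e t by (intro add_mono mult_left_mono) (auto simp: C_h_def)
    finally show ?thesis
      by simp
  qed
  then show "(1 - t) *\<^sub>R p + t *\<^sub>R q \<in> C"
    using subspace_add[OF subspace_Y Y(3,4)] by (simp add: C_h_def)
qed

text \<open>Every interior edge is labelled by its lower left cell, and each cell carries at most
  one edge of either kind.\<close>

lemma card_interior_edges: "finite (interior_edges m1 m2)" "card (interior_edges m1 m2) \<le> 2 * (m1 * m2)"
proof -
  let ?I = "{..<m1} \<times> {..<m2}"
  have sub: "interior_edges m1 m2 \<subseteq> (\<lambda>(i, j). VEdge i j) ` ?I \<union> (\<lambda>(i, j). HEdge i j) ` ?I" (is "_ \<subseteq> ?A \<union> ?B")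
    by (auto simp: interior_edges_def)
  have fin: "finite (?A \<union> ?B)"
    by simp
  show "finite (interior_edges m1 m2)"
    using sub fin by (rule finite_subset)
  have "card (interior_edges m1 m2) \<le> card (?A \<union> ?B)"
    using fin sub by (rule card_mono)
  also have "\<dots> \<le> card ?A + card ?B"
    by (rule card_Un_le)
  also have "\<dots> \<le> card ?I + card ?I"
    by (intro add_mono card_image_le) auto
  finally show "card (interior_edges m1 m2) \<le> 2 * (m1 * m2)"
    by simp
qed

lemma measure_domain: "measure lborel \<Omega> = real m1 * real m2 * h\<^sup>2"
proof -
  have "\<Omega> = box (0, 0) (real m1 * h, real m2 * h)"
    by (auto simp: domain_def mem_box Basis_prod_def)
  then show ?thesis
    using h_pos by (simp add: measure_lborel_box_eq Basis_prod_def power2_eq_square)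
qed

text \<open>Each edge mean of the difference is at most 2 in modulus, hence 4 after squaring; there
  are at most \<open>2 * (m1 * m2)\<close> edges, and \<open>h\<^sup>2 * m1 * m2\<close> is the
  area.\<close>

lemma norm_Y_diff_le:
  assumes "p \<in> C" "q \<in> C"
  shows "(norm_Y m1 m2 h (p - q))\<^sup>2 \<le> 8 * measure lborel \<Omega>"
proof -
  have Y: "p \<in> Y" "q \<in> Y"
    using assms by (auto simp: C_h_def)
  have "(edge_mean h (p - q) e)\<^sup>2 \<le> 4" if e: "e \<in> interior_edges m1 m2" for e
  proof -
    have "p - q = p + (- 1) *\<^sub>R q"
      by (simp add: fun_eq_iff)
    then have "edge_mean h (p - q) e = edge_mean h p e - edge_mean h q e"
      using edge_mean_add[OF Y(1) subspace_scale[OF subspace_Y Y(2)] e, of "- 1"]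
        edge_mean_scaleR[OF Y(2) e, of "- 1"]
      by simp
    moreover have "\<bar>edge_mean h p e\<bar> \<le> 1" "\<bar>edge_mean h q e\<bar> \<le> 1"
      using assms e by (auto simp: C_h_def)
    ultimately have "\<bar>edge_mean h (p - q) e\<bar> \<le> 2"
      by linarith
    then have "\<bar>edge_mean h (p - q) e\<bar>\<^sup>2 \<le> 2\<^sup>2"
      by (intro power_mono) auto
    then show ?thesis
      by simp
  qed
  then have "(\<Sum>e\<in>interior_edges m1 m2. (edge_mean h (p - q) e)\<^sup>2) \<le> real (card (interior_edges m1 m2)) * 4"
    by (rule sum_bounded_above)
  also have "\<dots> \<le> real (2 * (m1 * m2)) * 4"
    using card_interior_edges(2) by (intro mult_right_mono of_nat_mono) auto
  finally have "h\<^sup>2 * (\<Sum>e\<in>interior_edges m1 m2. (edge_mean h (p - q) e)\<^sup>2) \<le> h\<^sup>2 * (real (2 * (m1 * m2)) * 4)"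
    by (intro mult_left_mono) auto
  moreover have "(norm_Y m1 m2 h (p - q))\<^sup>2 = h\<^sup>2 * (\<Sum>e\<in>interior_edges m1 m2. (edge_mean h (p - q) e)\<^sup>2)"
    unfolding norm_Y_def inner_Y_def power2_eq_square[symmetric]
    by (intro real_sqrt_pow2 mult_nonneg_nonneg sum_nonneg) auto
  ultimately show ?thesis
    by (simp add: measure_domain algebra_simps)
qed

end

text \<open>Reciprocals grow by at least \<open>c\<close> per step, since \<open>(z n - c * (z
  n)\<^sup>2) * (1 / z n + c) = 1 - (c * z n)\<^sup>2\<close>. The multiplicative form avoids
  dividing by \<open>z (Suc n)\<close>, which may vanish.\<close>

lemma inverse_linear_decay:
  fixes z :: "nat \<Rightarrow> real"
  assumes "0 < c" "0 < z 0" and nonneg: "\<And>n. 0 \<le> z n" and step: "\<And>n. z (Suc n) \<le> z n - c * (z n)\<^sup>2"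
  shows "z n \<le> 1 / (c * real n + 1 / z 0)"
proof (induction n)
  case 0
  then show ?case
    by simp
next
  case (Suc n)
  define y where "y = c * real n + 1 / z 0"
  have y: "0 < y"
    using assms(1,2) by (simp add: y_def add_nonneg_pos)
  show ?case
  proof (cases "z n = 0")
    case True
    then have "z (Suc n) \<le> 0"
      using step[of n] by simp
    also have "0 \<le> 1 / (c * real (Suc n) + 1 / z 0)"
      using assms(1,2) by simp
    finally show ?thesis .
  next
    case False
    then have z: "0 < z n"
      using nonneg[of n] by simp
    have "y \<le> 1 / z n"
      using Suc.IH y z by (simp add: y_def[symmetric] field_simps)
    have "z (Suc n) * (1 / z n + c) \<le> (z n - c * (z n)\<^sup>2) * (1 / z n + c)"
      using step[of n] z assms(1) by (intro mult_right_mono) auto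
    also have "\<dots> = 1 - (c * z n)\<^sup>2"
      using z by (simp add: field_simps power2_eq_square)
    also have "\<dots> \<le> 1"
      by simp
    finally have "z (Suc n) * (1 / z n + c) \<le> 1" .
    moreover have "z (Suc n) * (y + c) \<le> z (Suc n) * (1 / z n + c)"
      using \<open>y \<le> 1 / z n\<close> nonneg by (intro mult_left_mono) auto
    ultimately have "z (Suc n) \<le> 1 / (y + c)"
      using y assms(1) by (simp add: pos_le_divide_eq)
    then show ?thesis
      by (simp add: y_def algebra_simps)
  qed
qed

section \<open>Energy decrease along the iteration\<close>

context grid
begin

lemma div_h_sum:
  assumes "finite K" "\<And>k. k \<in> K \<Longrightarrow> q k \<in> Y"
  shows "div_h m1 m2 h (\<Sum>k\<in>K. q k) = (\<Sum>k\<in>K. div_h m1 m2 h (q k))"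
  using assms
proof (induction K rule: finite_induct)
  case empty
  show ?case
    using div_h_scaleR[OF subspace_0[OF subspace_Y], of 0] unfolding scaleR_zero_left sum.empty .
next
  case (insert k K)
  have "div_h m1 m2 h (q k + (\<Sum>k\<in>K. q k)) = div_h m1 m2 h (q k) + div_h m1 m2 h (\<Sum>k\<in>K. q k)"
    using insert.prems subspace_sum[OF subspace_Y, of K q] by (intro div_h_add) auto
  also have "div_h m1 m2 h (\<Sum>k\<in>K. q k) = (\<Sum>k\<in>K. div_h m1 m2 h (q k))"
    using insert.prems by (intro insert.IH) auto
  finally show ?case
    by (simp only: sum.insert[OF insert.hyps])
qed

text \<open>The third claim assumes a strictly positive initial gap, which makes \<open>K\<close>
  positive; the first two also serve the case of a vanishing initial gap.\<close>

lemma additive_schwarz_decrease: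
  fixes F \<alpha> \<beta> N W c1 c2 \<tau> p p_star E K
  defines "E \<equiv> dual_energy m1 m2 h F"
    and "K \<equiv> \<beta> / \<alpha> * c1 * (\<alpha> * (E (p 0) - E p_star)) + 4 * c2 * measure lborel \<Omega> + \<alpha> * (E (p 0) - E p_star)"
  assumes \<alpha>: "0 < \<alpha>" "strongly_convex_X m1 m2 h \<alpha> F"
    and \<beta>: "0 < \<beta>" "has_lipschitz_derivative_X m1 m2 h \<beta> F"
    and c: "0 < c1" "0 \<le> c2"
    and W: "space_decomposition m1 m2 h N W" "stable_decomposition m1 m2 h N W c1 c2"
    and \<tau>: "0 < \<tau>" "\<tau> \<le> 1 / real N"
    and p: "additive_schwarz m1 m2 h F N W \<tau> p"
    and p_star: "minimizes E C p_star"
  shows "E p_star \<le> E (p n)" "E (p (Suc n)) \<le> E (p n)"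
    and "E p_star < E (p 0) \<Longrightarrow>
      \<alpha> * (E (p (Suc n)) - E p_star) \<le> \<alpha> * (E (p n) - E p_star) - \<tau> / (4 * K) * (\<alpha> * (E (p n) - E p_star))\<^sup>2"
proof -
  let ?div = "div_h m1 m2 h" and ?G = "X.conjugate F"
  have E: "E q = ?G (?div q)" for q
    by (simp add: E_def dual_energy_def conjugate_X_def X.conjugate_def)
  have conv: "convex_on X (\<lambda>u. F u - \<alpha> / 2 * (norm_X m1 m2 h u)\<^sup>2)"
    using \<alpha> by (simp add: strongly_convex_X_def)
  obtain F' where F': "\<And>u. u \<in> X \<Longrightarrow> X.gradient_at F (F' u) u"
    "\<And>u v. u \<in> X \<Longrightarrow> v \<in> X \<Longrightarrow> norm_X m1 m2 h (F' u - F' v) \<le> \<beta> * norm_X m1 m2 h (u - v)"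
    using \<beta>(2) unfolding has_lipschitz_derivative_X_def has_frechet_derivative_X_def X.gradient_at_def
    by blast
  have bounds: "\<exists>g\<in>X.
      (\<forall>w\<in>X. ?G v + inner_X m1 m2 h g (w - v) + 1 / (2 * \<beta>) * (norm_X m1 m2 h (w - v))\<^sup>2 \<le> ?G w) \<and>
      (\<forall>w\<in>X. ?G w \<le> ?G v + inner_X m1 m2 h g (w - v) + 1 / (2 * \<alpha>) * (norm_X m1 m2 h (w - v))\<^sup>2)"
    if v: "v \<in> X" for v
  proof (rule X.conjugate_quadratic_bounds[OF \<alpha>(1) \<beta>(1) conv])
    show "X.gradient_at F (F' u) u" if "u \<in> X" for u
      using F'(1)[OF that] .
    show "norm_X m1 m2 h (F' u - F' w) \<le> \<beta> * norm_X m1 m2 h (u - w)" if "u \<in> X" "w \<in> X" for u w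
      using F'(2)[OF that] .
    show "v \<in> X"
      by (rule v)
  qed blast
  have W_Y: "subspace (W k) \<and> W k \<subseteq> Y" if "k \<in> {1..N}" for k
    using W(1) that unfolding space_decomposition_def by blast
  have N: "1 \<le> N" "real N * \<tau> \<le> 1"
    using W(1) \<tau> unfolding space_decomposition_def by (auto simp: field_simps)
  have C_Y: "q \<in> Y" if "q \<in> C" for q
    using that by (simp add: C_h_def)
  have div_X: "?div q \<in> X" if "q \<in> Y" for q
    using div_h_properties(1)[OF that] .
  obtain r where r: "\<And>n k. k \<in> {1..N} \<Longrightarrow>
      minimizes (\<lambda>s. E (p n + s)) {s \<in> W k. p n + s \<in> C} (r n k)"
    and p_Suc: "\<And>n. p (Suc n) = p n + \<tau> *\<^sub>R (\<Sum>k=1..N. r n k)"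
  proof -
    have "\<forall>n. \<exists>r. (\<forall>k\<in>{1..N}. minimizes (\<lambda>s. E (p n + s)) {s \<in> W k. p n + s \<in> C} (r k)) \<and>
        p (Suc n) = p n + \<tau> *\<^sub>R (\<Sum>k=1..N. r k)"
      using p unfolding additive_schwarz_def E_def by blast
    from choice[OF this] show thesis
      using that by blast
  qed
  have r_mem: "r n k \<in> W k" "p n + r n k \<in> C" "r n k \<in> Y" if "k \<in> {1..N}" for n k
    using r[OF that, of n] W_Y[OF that] unfolding minimizes_def by blast+
  have p_C: "p n \<in> C" for n
  proof (induction n)
    case 0
    then show ?case
      using p by (simp add: additive_schwarz_def)
  next
    case (Suc n)
    \<comment> \<open>The average of the locally corrected fields. The next iterate lies between
      \<open>p n\<close> and \<open>q\<close>, with weight \<open>real N * \<tau> \<le> 1\<close> on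
      \<open>q\<close>.\<close>
    define q where "q = (\<Sum>k=1..N. (1 / real N) *\<^sub>R (p n + r n k))"
    have q: "q \<in> C"
      unfolding q_def using N r_mem by (intro convex_sum convex_C) auto
    have "q = p n + (1 / real N) *\<^sub>R (\<Sum>k=1..N. r n k)"
      using N unfolding q_def by (simp add: scaleR_add_right sum.distrib scaleR_sum_right sum_constant_scaleR del: sum_constant)
    then have "p (Suc n) = (1 - real N * \<tau>) *\<^sub>R p n + (real N * \<tau>) *\<^sub>R q"
      using N unfolding p_Suc by (simp add: algebra_simps)
    moreover have "(1 - real N * \<tau>) *\<^sub>R p n + (real N * \<tau>) *\<^sub>R q \<in> C"
      using N(2) \<tau>(1) by (intro convexD_alt[OF convex_C Suc q]) auto
    ultimately show ?case
      by (simp only:)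
  qed
  have star: "p_star \<in> C" "\<And>q. q \<in> C \<Longrightarrow> E p_star \<le> E q"
    using p_star by (auto simp: minimizes_def)
  show "E p_star \<le> E (p n)" for n
    using star p_C by blast
  note nonneg = this
  have div_sum: "?div (\<Sum>k=1..N. q k) = (\<Sum>k=1..N. ?div (q k)) \<and> (\<Sum>k=1..N. q k) \<in> Y"
    if "\<And>k. k \<in> {1..N} \<Longrightarrow> q k \<in> Y" for q
    using div_h_sum[of "{1..N}" q] subspace_sum[OF subspace_Y, of "{1..N}" q] that by simp
  \<comment> \<open>The parameter stays free: \<open>t = 0\<close> gives monotonicity of the energy,
    and an optimized \<open>t\<close> gives the quadratic decrease.\<close>
  have step: "E (p (Suc n)) \<le> E (p n) + \<tau> * (t * (E p_star - E (p n)) + t\<^sup>2 / (2 * \<alpha>) *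
      (c1 * (norm_X m1 m2 h (?div (p_star - p n)))\<^sup>2 + c2 * (norm_Y m1 m2 h (p_star - p n))\<^sup>2))"
    if t: "0 \<le> t" "t \<le> 1" for n t
  proof -
    obtain s where s: "\<And>k. k \<in> {1..N} \<Longrightarrow> s k \<in> W k" "p_star - p n = (\<Sum>k=1..N. s k)"
      "\<And>k. k \<in> {1..N} \<Longrightarrow> p n + s k \<in> C"
      and s_le: "(\<Sum>k=1..N. (norm_X m1 m2 h (?div (s k)))\<^sup>2)
        \<le> c1 * (norm_X m1 m2 h (?div (p_star - p n)))\<^sup>2 + c2 * (norm_Y m1 m2 h (p_star - p n))\<^sup>2"
      using W(2) star(1) p_C[of n] unfolding stable_decomposition_def by metis
    have s_Y: "s k \<in> Y" if "k \<in> {1..N}" for k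
      using s(1)[OF that] W_Y[OF that] by blast
    let ?v = "?div (p n)"
    have div_p: "?div (p n + q) = ?v + ?div q" if "q \<in> Y" for q
      using div_h_add C_Y[OF p_C] that by blast
    have "?G (?v + \<tau> *\<^sub>R (\<Sum>k\<in>{1..N}. ?div (r n k)))
      \<le> ?G ?v + \<tau> * (t * (?G (?div p_star) - ?G ?v) + t\<^sup>2 / (2 * \<alpha>) * (\<Sum>k\<in>{1..N}. (norm_X m1 m2 h (?div (s k)))\<^sup>2))"
    proof (rule X.parallel_step_bound)
      fix v
      assume "v \<in> X"
      then obtain g where g: "g \<in> X"
        "\<And>w. w \<in> X \<Longrightarrow> ?G v + inner_X m1 m2 h g (w - v) + 1 / (2 * \<beta>) * (norm_X m1 m2 h (w - v))\<^sup>2 \<le> ?G w"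
        "\<And>w. w \<in> X \<Longrightarrow> ?G w \<le> ?G v + inner_X m1 m2 h g (w - v) + 1 / (2 * \<alpha>) * (norm_X m1 m2 h (w - v))\<^sup>2"
        using bounds by blast
      have "0 \<le> 1 / (2 * \<beta>) * (norm_X m1 m2 h (w - v))\<^sup>2" for w
        using \<beta>(1) by simp
      then show "\<exists>g\<in>X. \<forall>w\<in>X. ?G v + inner_X m1 m2 h g (w - v) \<le> ?G w \<and>
          ?G w \<le> ?G v + inner_X m1 m2 h g (w - v) + 1 / (2 * \<alpha>) * (norm_X m1 m2 h (w - v))\<^sup>2"
        using g by (meson add_increasing2 order_refl order_trans le_add_same_cancel1)
    next
      show "?div p_star - ?v = (\<Sum>k\<in>{1..N}. ?div (s k))"
        using div_sum[of s] s_Y s(2) div_p[of "p_star - p n"] by (simp add: algebra_simps)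
      fix k
      assume k: "k \<in> {1..N}"
      \<comment> \<open>The scaled piece competes in the local problem: convexity of
        \<open>C\<close> keeps it feasible and \<open>W k\<close> is closed under scaling.\<close>
      have "p n + t *\<^sub>R s k \<in> C"
      proof -
        have "p n + t *\<^sub>R s k = (1 - t) *\<^sub>R p n + t *\<^sub>R (p n + s k)"
          by (simp add: algebra_simps)
        then show ?thesis
          using convexD_alt[OF convex_C p_C s(3)[OF k] t] by simp
      qed
      moreover have "t *\<^sub>R s k \<in> W k"
        using s(1) k W_Y by (simp add: subspace_scale)
      ultimately have "E (p n + r n k) \<le> E (p n + t *\<^sub>R s k)"
        using r[OF k] by (simp add: minimizes_def)
      then show "?G (?v + ?div (r n k)) \<le> ?G (?v + t *\<^sub>R ?div (s k))"
        using s_Y[OF k] r_mem(3)[OF k] subspace_scale[OF subspace_Y]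
        by (simp add: E div_p div_h_scaleR)
    qed (use \<tau> N t r_mem s_Y div_X C_Y p_C star in auto)
    moreover have "?div (p (Suc n)) = ?v + \<tau> *\<^sub>R (\<Sum>k\<in>{1..N}. ?div (r n k))"
      using div_sum[of "r n"] r_mem(3) subspace_scale[OF subspace_Y]
      by (simp add: p_Suc div_p div_h_scaleR)
    moreover have "\<tau> * (t\<^sup>2 / (2 * \<alpha>) * (\<Sum>k=1..N. (norm_X m1 m2 h (?div (s k)))\<^sup>2))
        \<le> \<tau> * (t\<^sup>2 / (2 * \<alpha>) * (c1 * (norm_X m1 m2 h (?div (p_star - p n)))\<^sup>2 + c2 * (norm_Y m1 m2 h (p_star - p n))\<^sup>2))"
      using s_le \<tau> \<alpha> by (intro mult_left_mono) auto
    ultimately show ?thesis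
      by (simp add: E distrib_left)
  qed
  show mono: "E (p (Suc n)) \<le> E (p n)" for n
    using step[of 0 n] by simp
  assume pos: "E p_star < E (p 0)"
  define \<zeta> where "\<zeta> = (\<lambda>n. \<alpha> * (E (p n) - E p_star))"
  have \<zeta>_le: "\<zeta> n \<le> \<zeta> 0"
    using lift_Suc_antimono_le[of "\<lambda>n. E (p n)" 0 n] mono \<alpha> by (simp add: \<zeta>_def)
  have \<zeta>_pos: "0 < \<zeta> 0" "0 \<le> \<zeta> n"
    using pos nonneg[of n] \<alpha> by (auto simp: \<zeta>_def)
  have K: "K = \<beta> / \<alpha> * c1 * \<zeta> 0 + 4 * c2 * measure lborel \<Omega> + \<zeta> 0"
    by (simp add: K_def \<zeta>_def)
  have "0 \<le> \<beta> / \<alpha> * c1 * \<zeta> 0" "0 \<le> 4 * c2 * measure lborel \<Omega>"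
    using \<alpha> \<beta> c \<zeta>_pos by auto
  then have K_ge: "\<zeta> 0 \<le> K"
    by (simp add: K)
  then have K_pos: "0 < K"
    using \<zeta>_pos by simp
  have growth: "(norm_X m1 m2 h (?div (p_star - p n)))\<^sup>2 \<le> 2 * (\<beta> / \<alpha>) * \<zeta> n"
  proof -
    have X: "?div p_star \<in> X" "?div (p n) \<in> X"
      using star p_C C_Y div_X by auto
    obtain g where g: "g \<in> X"
      "\<And>w. w \<in> X \<Longrightarrow> ?G (?div p_star) + inner_X m1 m2 h g (w - ?div p_star)
        + 1 / (2 * \<beta>) * (norm_X m1 m2 h (w - ?div p_star))\<^sup>2 \<le> ?G w"
      "\<And>w. w \<in> X \<Longrightarrow> ?G w \<le> ?G (?div p_star) + inner_X m1 m2 h g (w - ?div p_star)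
        + 1 / (2 * \<alpha>) * (norm_X m1 m2 h (w - ?div p_star))\<^sup>2"
      using bounds[OF X(1)] by blast
    have div_diff: "?div (q - q') = ?div q - ?div q'" if "q \<in> Y" "q' \<in> Y" for q q'
      using div_h_add[of "q - q'" q'] that subspace_diff[OF subspace_Y that] by (simp add: algebra_simps)
    have "1 / (2 * \<beta>) * (norm_X m1 m2 h (?div (p n) - ?div p_star))\<^sup>2 \<le> ?G (?div (p n)) - ?G (?div p_star)"
    proof (rule X.minimum_quadratic_growth[OF g X])
      fix t :: real
      assume t: "0 < t" "t \<le> 1"
      \<comment> \<open>Minimality over \<open>C\<close> passes to the segment between the two
        divergences because \<open>C\<close> is convex and the divergence is linear.\<close>
      have "p_star + t *\<^sub>R (p n - p_star) = (1 - t) *\<^sub>R p_star + t *\<^sub>R p n"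
        by (simp add: algebra_simps)
      then have "p_star + t *\<^sub>R (p n - p_star) \<in> C"
        using convexD_alt[OF convex_C star(1) p_C, of t n] t by simp
      then have "E p_star \<le> E (p_star + t *\<^sub>R (p n - p_star))"
        by (rule star)
      also have "?div (p_star + t *\<^sub>R (p n - p_star)) = ?div p_star + t *\<^sub>R (?div (p n) - ?div p_star)"
        using C_Y[OF p_C[of n]] C_Y[OF star(1)] subspace_scale[OF subspace_Y] subspace_diff[OF subspace_Y]
        by (simp add: div_h_add div_h_scaleR div_diff)
      then have "E (p_star + t *\<^sub>R (p n - p_star)) = ?G (?div p_star + t *\<^sub>R (?div (p n) - ?div p_star))"
        by (simp add: E)
      finally show "?G (?div p_star) \<le> ?G (?div p_star + t *\<^sub>R (?div (p n) - ?div p_star))"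
        by (simp add: E)
    qed
    then have "(norm_X m1 m2 h (?div (p n) - ?div p_star))\<^sup>2 \<le> 2 * \<beta> * (E (p n) - E p_star)"
      using \<beta>(1) by (simp add: E pos_divide_le_eq mult.commute)
    also have "\<dots> = 2 * (\<beta> / \<alpha>) * \<zeta> n"
      using \<alpha>(1) by (simp add: \<zeta>_def)
    finally have "(norm_X m1 m2 h (?div (p n) - ?div p_star))\<^sup>2 \<le> 2 * (\<beta> / \<alpha>) * \<zeta> n" .
    then show ?thesis
      using X.nrm_minus_commute[OF X] C_Y[OF p_C[of n]] C_Y[OF star(1)] by (simp add: div_diff)
  qed
  \<comment> \<open>This value maximizes \<open>t * \<zeta> n - t\<^sup>2 * K\<close>; it is at most
    1 because \<open>\<zeta> n \<le> \<zeta> 0 \<le> K\<close>.\<close>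
  define t where "t = \<zeta> n / (2 * K)"
  have t: "0 \<le> t" "t \<le> 1"
    using K_pos \<zeta>_pos \<zeta>_le K_ge by (auto simp: t_def)
  define B where "B = c1 * (norm_X m1 m2 h (?div (p_star - p n)))\<^sup>2 + c2 * (norm_Y m1 m2 h (p_star - p n))\<^sup>2"
  have "B \<le> c1 * (2 * (\<beta> / \<alpha>) * \<zeta> n) + c2 * (8 * measure lborel \<Omega>)"
    unfolding B_def using growth norm_Y_diff_le[OF star(1) p_C] c by (intro add_mono mult_left_mono) auto
  also have "c1 * (2 * (\<beta> / \<alpha>) * \<zeta> n) \<le> c1 * (2 * (\<beta> / \<alpha>) * \<zeta> 0)"
    using \<zeta>_le c \<alpha> \<beta> by (intro mult_left_mono) auto
  \<comment> \<open>The bound reached so far equals \<open>2 * (K - \<zeta> 0)\<close>.\<close>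
  finally have B: "B \<le> 2 * K"
    using \<zeta>_pos by (simp add: K algebra_simps)
  have "\<zeta> (Suc n) \<le> \<alpha> * (E (p n) + \<tau> * (t * (E p_star - E (p n)) + t\<^sup>2 / (2 * \<alpha>) * B) - E p_star)"
    using step[OF t, of n] \<alpha> by (simp add: \<zeta>_def B_def)
  also have "\<dots> = \<zeta> n - \<tau> * (t * \<zeta> n - t\<^sup>2 / 2 * B)"
    using \<alpha> by (simp add: \<zeta>_def field_simps)
  also have "\<dots> \<le> \<zeta> n - \<tau> * (t * \<zeta> n - t\<^sup>2 / 2 * (2 * K))"
    using B \<tau> by (intro diff_left_mono mult_left_mono) auto
  also have "t * \<zeta> n - t\<^sup>2 / 2 * (2 * K) = (\<zeta> n)\<^sup>2 / (4 * K)"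
    using K_pos by (simp add: t_def power2_eq_square field_simps)
  finally show "\<alpha> * (E (p (Suc n)) - E p_star) \<le> \<alpha> * (E (p n) - E p_star) - \<tau> / (4 * K) * (\<alpha> * (E (p n) - E p_star))\<^sup>2"
    by (simp add: \<zeta>_def)
qed

end

text \<open>Quantifying the function \<open>c_tilde\<close> before all the data expresses that the
  constant depends on its six arguments alone.\<close>

theorem theorem3p3:
  shows "\<exists>c_tilde :: real \<Rightarrow> real \<Rightarrow> real \<Rightarrow> real \<Rightarrow> real \<Rightarrow> real \<Rightarrow> real.
    \<forall>(m1::nat) (m2::nat) (h::real) (F :: scalar_field \<Rightarrow> real) (\<alpha>::real) (\<beta>::real)
      (N::nat) (W :: nat \<Rightarrow> vector_field set) (c1::real) (c2::real) (\<tau>::real)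
      (p :: nat \<Rightarrow> vector_field) (p_star :: vector_field).
      1 \<le> m1 \<and> 1 \<le> m2 \<and> 0 < h \<and>
      0 < \<alpha> \<and> strongly_convex_X m1 m2 h \<alpha> F \<and>
      0 < \<beta> \<and> has_lipschitz_derivative_X m1 m2 h \<beta> F \<and>
      0 < c1 \<and> 0 \<le> c2 \<and>
      space_decomposition m1 m2 h N W \<and> stable_decomposition m1 m2 h N W c1 c2 \<and>
      0 < \<tau> \<and> \<tau> \<le> 1 / real N \<and>
      additive_schwarz m1 m2 h F N W \<tau> p \<and>
      minimizes (dual_energy m1 m2 h F) (C_h m1 m2 h) p_star \<longrightarrow>
      (let \<kappa> = \<beta> / \<alpha>;
           \<zeta> = (\<lambda>n. \<alpha> * (dual_energy m1 m2 h F (p n) - dual_energy m1 m2 h F p_star));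
           c = c_tilde (measure lborel (domain m1 m2 h)) \<kappa> \<tau> (\<zeta> 0) c1 c2
       in 0 < c \<and>
          (\<forall>n. \<zeta> n \<le> (if \<zeta> 0 = 0 then 0 else 1 / (c * real n + 1 / \<zeta> 0))))"
proof -
  let ?K = "\<lambda>\<omega> \<kappa> z c1 c2 :: real. \<kappa> * c1 * z + 4 * c2 * \<omega> + z"
  \<comment> \<open>For \<open>z = 0\<close> the claimed bound is 0 whatever the rate, so 1 is just
    a positive default; \<open>?K\<close> itself could vanish there.\<close>
  let ?c = "\<lambda>\<omega> \<kappa> \<tau> z c1 c2. if z = 0 then 1 else \<tau> / (4 * ?K \<omega> \<kappa> z c1 c2)"
  show ?thesis
  proof (intro exI[of _ ?c] allI impI, elim conjE)
    fix m1 m2 :: nat and h :: real and F \<alpha> \<beta> and N :: nat and W c1 c2 \<tau> p p_star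
    assume h: "0 < h"
      and asms: "0 < \<alpha>" "strongly_convex_X m1 m2 h \<alpha> F" "0 < \<beta>" "has_lipschitz_derivative_X m1 m2 h \<beta> F"
        "0 < c1" "0 \<le> c2" "space_decomposition m1 m2 h N W" "stable_decomposition m1 m2 h N W c1 c2"
        "0 < \<tau>" "\<tau> \<le> 1 / real N" "additive_schwarz m1 m2 h F N W \<tau> p"
        "minimizes (dual_energy m1 m2 h F) (C_h m1 m2 h) p_star"
    interpret grid m1 m2 h
      using h by unfold_locales
    define E where "E = dual_energy m1 m2 h F"
    define \<zeta> where "\<zeta> = (\<lambda>n. \<alpha> * (E (p n) - E p_star))"
    define c where "c = ?c (measure lborel \<Omega>) (\<beta> / \<alpha>) \<tau> (\<zeta> 0) c1 c2"
    note decrease = additive_schwarz_decrease[OF asms, folded E_def]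
    have nonneg: "0 \<le> \<zeta> n" for n
      using decrease(1) asms(1) by (simp add: \<zeta>_def)
    have "0 < c \<and> (\<forall>n. \<zeta> n \<le> (if \<zeta> 0 = 0 then 0 else 1 / (c * real n + 1 / \<zeta> 0)))"
    proof (cases "\<zeta> 0 = 0")
      case True
      \<comment> \<open>A start at the minimal value: monotonicity keeps every
        \<open>\<zeta> n\<close> at most \<open>\<zeta> 0 = 0\<close>.\<close>
      have "E (p n) \<le> E (p 0)" for n
        using lift_Suc_antimono_le[of "\<lambda>n. E (p n)" 0 n] decrease(2) by simp
      then have "\<zeta> n \<le> \<zeta> 0" for n
        using asms(1) by (simp add: \<zeta>_def)
      then show ?thesis
        using True by (simp add: c_def)
    next
      case False
      then have pos: "0 < \<zeta> 0"
        using nonneg[of 0] by simp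
      then have "E p_star < E (p 0)"
        using asms(1) by (simp add: \<zeta>_def zero_less_mult_iff)
      then have step: "\<zeta> (Suc n) \<le> \<zeta> n - c * (\<zeta> n)\<^sup>2" for n
        using decrease(3)[of n] False by (simp add: c_def \<zeta>_def)
      have "0 \<le> \<beta> / \<alpha> * c1 * \<zeta> 0" "0 \<le> 4 * c2 * measure lborel \<Omega>"
        using asms pos by auto
      then have "0 < c"
        using pos asms(9) False by (simp add: c_def)
      then show ?thesis
        using inverse_linear_decay[of c \<zeta>, OF _ pos nonneg step] False by simp
    qed
    then show "let \<kappa> = \<beta> / \<alpha>;
           \<zeta> = (\<lambda>n. \<alpha> * (dual_energy m1 m2 h F (p n) - dual_energy m1 m2 h F p_star));
           c = ?c (measure lborel (domain m1 m2 h)) \<kappa> \<tau> (\<zeta> 0) c1 c2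
       in 0 < c \<and>
          (\<forall>n. \<zeta> n \<le> (if \<zeta> 0 = 0 then 0 else 1 / (c * real n + 1 / \<zeta> 0)))"
      unfolding Let_def c_def \<zeta>_def E_def .
  qed
qed

end
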